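(* Let $n\ge 2$ be an integer and let $M(C_{2n})$ denote the middle graph of the cycle $C_{2n}$ on $2n$ vertices. If $G$ is a finite connected graph which satisfies the odd two-pebbling property, then $$f(M(C_{2n})\times G)\leq f(M(C_{2n}))\,f(G)=(2^{n+1}+2n-2)\,f(G).$$
   Context: All graphs are finite, simple and connected. A distribution of pebbles on a graph assigns to each vertex a nonnegative integer number of pebbles. A pebbling move removes two pebbles from one vertex and places one pebble on an adjacent vertex. The pebbling number $f(G)$ is the least integer $p$ such that, from every distribution of $p$ pebbles on the vertices of $G$ and for every target vertex $v$ of $G$, it is possible by a (possibly empty) sequence of pebbling moves to place at least one pebble on $v$. A graph $G$ satisfies the odd two-pebbling property if, for every distribution of $p$ pebbles on $G$ in which exactly $r$ vertices carry an odd number of pebbles and $p>2f(G)-r$, and for every vertex $v$ of $G$, it is possible by a sequence of pebbling moves to have at least two pebbles on $v$. The middle graph $M(G)$ of a graph $G$ is obtained from $G$ by inserting a new vertex into each edge of $G$ (subdividing the edge), and joining two new vertices by an edge whenever the two edges of $G$ into which they were inserted share a vertex of $G$. Explicitly, $M(C_{2n})$ has vertices $v_0,\dots,v_{2n-1},u_0,\dots,u_{2n-1}$ and edges $v_iu_i$, $u_iv_{i+1}$, $u_iu_{i+1}$ for $0\le i\le 2n-1$, indices modulo $2n$. The Cartesian product $G\times H$ has vertex set $V(G)\times V(H)$; its edges are the pairs $\{(a,v),(b,v)\}$ with $\{a,b\}\in E(G)$, $v\in V(H)$, and the pairs $\{(u,x),(u,y)\}$ with $u\in V(G)$, $\{x,y\}\in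 E(H)$. *)

theory Defs
  imports "Graph_Theory.Graph_Theory"
begin

text \<open>
  A finite simple graph is a \<^locale>\<open>pair_graph\<close>: a finite, loopfree, symmetric digraph whose arcs
  are pairs of vertices, an undirected edge being the two arcs \<open>(u, v)\<close>, \<open>(v, u)\<close>.
  The library's \<^const>\<open>connected\<close> includes that there is at least one vertex.

  A distribution is a function \<open>'a \<Rightarrow> nat\<close> of which only the values on the vertex set matter:
  moves follow arcs, so in a well-formed graph values elsewhere are neither counted nor used.
\<close>

definition pebbles :: "'a pair_pre_digraph \<Rightarrow> ('a \<Rightarrow> nat) \<Rightarrow> nat" where
  "pebbles G D = (\<Sum>v\<in>pverts G. D v)"

inductive pebbling_move :: "'a pair_pre_digraph \<Rightarrow> ('a \<Rightarrow> nat) \<Rightarrow> ('a \<Rightarrow> nat) \<Rightarrow> bool"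
  for G :: "'a pair_pre_digraph" where
  "(u, v) \<in> parcs G \<Longrightarrow> 2 \<le> D u \<Longrightarrow> pebbling_move G D (D(u := D u - 2, v := D v + 1))"

definition can_pebble :: "'a pair_pre_digraph \<Rightarrow> ('a \<Rightarrow> nat) \<Rightarrow> 'a \<Rightarrow> nat \<Rightarrow> bool" where
  "can_pebble G D v k \<longleftrightarrow> (\<exists>D'. (pebbling_move G)\<^sup>*\<^sup>* D D' \<and> k \<le> D' v)"

definition pebbling_number :: "'a pair_pre_digraph \<Rightarrow> nat" where
  "pebbling_number G =
     (LEAST p. \<forall>D. pebbles G D = p \<longrightarrow> (\<forall>v\<in>pverts G. can_pebble G D v 1))"

definition odd_verts :: "'a pair_pre_digraph \<Rightarrow> ('a \<Rightarrow> nat) \<Rightarrow> 'a set" where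
  "odd_verts G D = {v \<in> pverts G. odd (D v)}"

text \<open>The condition \<open>p > 2 f(G) - r\<close> is written additively because subtraction on \<^typ>\<open>nat\<close>
  truncates.\<close>

definition odd_two_pebbling :: "'a pair_pre_digraph \<Rightarrow> bool" where
  "odd_two_pebbling G \<longleftrightarrow>
     (\<forall>D. pebbles G D + card (odd_verts G D) > 2 * pebbling_number G
        \<longrightarrow> (\<forall>v\<in>pverts G. can_pebble G D v 2))"

definition cycle_graph :: "nat \<Rightarrow> nat pair_pre_digraph" where
  "cycle_graph m =
     \<lparr> pverts = {..<m},
       parcs = {(i, j). i < m \<and> j < m \<and> (j = (i + 1) mod m \<or> i = (j + 1) mod m)} \<rparr>"

definition uedges :: "'a pair_pre_digraph \<Rightarrow> 'a set set" where
  "uedges G = {{u, v} | u v. (u, v) \<in> parcs G}"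

text \<open>\<open>Inl v\<close> is the original vertex \<open>v\<close>; \<open>Inr e\<close> is the vertex inserted into the edge \<open>e\<close>.\<close>

definition middle_graph :: "'a pair_pre_digraph \<Rightarrow> ('a + 'a set) pair_pre_digraph" where
  "middle_graph G =
     \<lparr> pverts = Inl ` pverts G \<union> Inr ` uedges G,
       parcs = {(Inl v, Inr e) | v e. e \<in> uedges G \<and> v \<in> e}
             \<union> {(Inr e, Inl v) | v e. e \<in> uedges G \<and> v \<in> e}
             \<union> {(Inr e, Inr e') | e e'. e \<in> uedges G \<and> e' \<in> uedges G \<and> e \<noteq> e' \<and> e \<inter> e' \<noteq> {}} \<rparr>"

definition cartesian_product ::
    "'a pair_pre_digraph \<Rightarrow> 'b pair_pre_digraph \<Rightarrow> ('a \<times> 'b) pair_pre_digraph" where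
  "cartesian_product G H =
     \<lparr> pverts = pverts G \<times> pverts H,
       parcs = {((a, v), (b, v)) | a b v. (a, b) \<in> parcs G \<and> v \<in> pverts H}
             \<union> {((u, x), (u, y)) | u x y. u \<in> pverts G \<and> (x, y) \<in> parcs H} \<rparr>"

lemma pair_graphI:
  assumes "finite (pverts G)"
    and "\<And>u v. (u, v) \<in> parcs G \<Longrightarrow> u \<in> pverts G \<and> v \<in> pverts G \<and> u \<noteq> v \<and> (v, u) \<in> parcs G"
  shows "pair_graph G"
proof -
  have "parcs G \<subseteq> pverts G \<times> pverts G" using assms(2) by auto
  then have "finite (parcs G)" using assms(1) by (meson finite_SigmaI finite_subset)
  then show ?thesis
    using assms by unfold_locales (auto simp: symmetric_def sym_def)
qed

lemma pair_graphD:
  assumes "pair_graph G"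
  shows "finite (pverts G)"
    and "(u, v) \<in> parcs G \<Longrightarrow> u \<in> pverts G \<and> v \<in> pverts G \<and> u \<noteq> v \<and> (v, u) \<in> parcs G"
proof -
  interpret pair_graph G by fact
  show "finite (pverts G)" by (rule pair_finite_verts)
  show "u \<in> pverts G \<and> v \<in> pverts G \<and> u \<noteq> v \<and> (v, u) \<in> parcs G" if "(u, v) \<in> parcs G"
    using that pair_no_loops[of "(u, v)"] pair_sym_arcs in_arcsD1 in_arcsD2
    by (auto simp: symmetric_def sym_def)
qed

lemma pair_graph_cycle_graph:
  assumes "3 \<le> m"
  shows "pair_graph (cycle_graph m)"
  by (rule pair_graphI) (use assms in \<open>auto simp: cycle_graph_def mod_Suc split: if_splits\<close>)

lemma pair_graph_middle_graph:
  assumes "pair_graph G"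
  shows "pair_graph (middle_graph G)"
proof (rule pair_graphI)
  have "uedges G \<subseteq> Pow (pverts G)"
    using pair_graphD(2)[OF assms] by (auto simp: uedges_def)
  then have "finite (uedges G)" and *: "\<And>e v. e \<in> uedges G \<Longrightarrow> v \<in> e \<Longrightarrow> v \<in> pverts G"
    using pair_graphD(1)[OF assms] by (auto intro: finite_subset)
  then show "finite (pverts (middle_graph G))"
    using pair_graphD(1)[OF assms] by (simp add: middle_graph_def)
  fix u v assume "(u, v) \<in> parcs (middle_graph G)"
  then show "u \<in> pverts (middle_graph G) \<and> v \<in> pverts (middle_graph G) \<and> u \<noteq> v
      \<and> (v, u) \<in> parcs (middle_graph G)"
    using * by (auto simp: middle_graph_def)
qed

lemma pair_graph_cartesian_product:
  assumes "pair_graph G" "pair_graph H"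
  shows "pair_graph (cartesian_product G H)"
  by (rule pair_graphI)
    (use pair_graphD[OF assms(1)] pair_graphD[OF assms(2)] in
      \<open>auto simp: cartesian_product_def\<close>)

lemma uedges_cycle_graph: "uedges (cycle_graph m) = {{i, (i + 1) mod m} | i. i < m}"
  by (fastforce simp: uedges_def cycle_graph_def insert_commute)

end

theory Submission
  imports Defs "HOL-Library.Function_Algebras"
begin

text \<open>
  Let \<open>f\<close> be the pebbling number of \<open>G\<close>, and for a vertex \<open>h\<close> of the middle graph let \<open>p\<close> be the
  number of pebbles in the fibre over \<open>h\<close> and \<open>r\<close> the number of its vertices with an odd number of
  pebbles; \<open>r \<le> f\<close>. A fibre can send \<open>(p - r) / 2\<close> pebbles to an adjacent fibre, or gather \<open>2 * k\<close>
  pebbles over the target vertex of \<open>G\<close> whenever \<open>p + r > 2 * k * f\<close>. So either gathering succeeds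
  or the transfer loses at most a bounded multiple of \<open>f\<close>.

  Seen from any root, the middle graph of an even cycle consists of two ladders from the root to an
  antipodal vertex \<open>w\<close>: a path \<open>x\<^sub>0, \<dots>, x\<^sub>m\<close> in which some steps \<open>x\<^sub>i\<^sub>-\<^sub>1 x\<^sub>i\<close> carry a further vertex
  \<open>z\<^sub>i\<close>. Emptying a ladder level by level towards the root loses in total \<open>(2 ^ m + m - 2) * f\<close>
  pebbles. If \<open>w\<close> has \<open>p + r \<le> 2 * f\<close>, it is emptied into one ladder and both ladders into the root.
  Otherwise two pebbles are gathered over \<open>w\<close> and the remaining pairs go to the fuller ladder, which
  now holds one gathered pebble at \<open>x\<^sub>m\<close>; an induction on the ladder shows that this suffices.
\<close>

section \<open>Pebbling moves\<close>

definition stack :: "'v \<Rightarrow> nat \<Rightarrow> 'v \<Rightarrow> nat" where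
  "stack v k = (\<lambda>w. if w = v then k else 0)"

lemma stack_add: "stack v (j + k) = stack v j + stack v k"
  by (auto simp: stack_def)

lemma stack_0 [simp]: "stack v 0 = 0"
  by (auto simp: stack_def)

text \<open>\<open>E\<close> is only a lower bound for what is reached, so surplus pebbles may be
  dropped. This makes the relation transitive and compatible with addition.\<close>

definition yields :: "'v pair_pre_digraph \<Rightarrow> ('v \<Rightarrow> nat) \<Rightarrow> ('v \<Rightarrow> nat) \<Rightarrow> bool" where
  "yields K D E \<longleftrightarrow> (\<exists>D'. (pebbling_move K)\<^sup>*\<^sup>* D D' \<and> E \<le> D')"

lemma can_pebble_iff_yields: "can_pebble K D v k \<longleftrightarrow> yields K D (stack v k)"
  by (auto simp: can_pebble_def yields_def stack_def le_fun_def)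

lemma pebbling_move_add:
  assumes "pebbling_move K D D'"
  shows "pebbling_move K (D + E) (D' + E)"
  using assms
proof cases
  case (1 u v)
  have "D' + E = (D + E)(u := (D + E) u - 2, v := (D + E) v + 1)"
    using 1 by (auto simp: fun_eq_iff)
  then show ?thesis
    using pebbling_move.intros[of u v K "D + E"] 1 by simp
qed

lemma pebbling_moves_add:
  assumes "(pebbling_move K)\<^sup>*\<^sup>* D D'"
  shows "(pebbling_move K)\<^sup>*\<^sup>* (D + E) (D' + E)"
  using assms
proof induction
  case (step y z)
  show ?case
    by (rule rtranclp.rtrancl_into_rtrancl, rule step.IH, rule pebbling_move_add, rule step.hyps)
qed simp

lemma yields_le: "E \<le> D \<Longrightarrow> yields K D E"
  by (auto simp: yields_def)

lemma yields_refl [simp]: "yields K D D"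
  by (rule yields_le) simp

lemma yields_trans:
  assumes "yields K D E" "yields K E F"
  shows "yields K D F"
proof -
  obtain D' E' where D': "(pebbling_move K)\<^sup>*\<^sup>* D D'" "E \<le> D'"
    and E': "(pebbling_move K)\<^sup>*\<^sup>* E E'" "F \<le> E'"
    using assms by (auto simp: yields_def)
  define R where "R = (\<lambda>v. D' v - E v)"
  have "D' = E + R"
    using D'(2) by (auto simp: R_def le_fun_def fun_eq_iff)
  then have "(pebbling_move K)\<^sup>*\<^sup>* D (E' + R)"
    using D'(1) pebbling_moves_add[OF E'(1), of R] by simp
  moreover have "F \<le> E' + R"
    using E'(2) by (auto simp: le_fun_def intro: trans_le_add1)
  ultimately show ?thesis
    by (auto simp: yields_def)
qed

lemma yields_add_right:
  assumes "yields K D E"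
  shows "yields K (D + R) (E + R)"
proof -
  obtain D' where "(pebbling_move K)\<^sup>*\<^sup>* D D'" "E \<le> D'"
    using assms by (auto simp: yields_def)
  then show ?thesis
    using pebbling_moves_add[of K D D' R] by (auto simp: yields_def le_fun_def)
qed

lemma yields_add:
  assumes "yields K D E" "yields K D' E'"
  shows "yields K (D + D') (E + E')"
proof (rule yields_trans)
  show "yields K (D + D') (E + D')"
    using assms(1) by (rule yields_add_right)
  show "yields K (E + D') (E + E')"
    using yields_add_right[OF assms(2), of E] by (simp only: add.commute)
qed

lemma sum_fun_apply: "(\<Sum>i\<in>I. g i) x = (\<Sum>i\<in>I. g i x)" for g :: "'i \<Rightarrow> 'v \<Rightarrow> nat"
  by (induction I rule: infinite_finite_induct) auto

lemma yields_sum: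
  assumes "\<And>i. i \<in> I \<Longrightarrow> yields K (A i) (B i)"
  shows "yields K (\<Sum>i\<in>I. A i) (\<Sum>i\<in>I. B i)"
  using assms by (induction I rule: infinite_finite_induct) (auto intro: yields_add)

lemma yields_arc:
  assumes "(u, v) \<in> parcs K"
  shows "yields K (stack u (2 * k)) (stack v k)"
proof (induction k)
  case 0
  then show ?case by simp
next
  case (Suc k)
  have "yields K (stack u 2) (stack v 1)"
    using pebbling_move.intros[OF assms, of "stack u 2"]
    by (auto simp: yields_def stack_def le_fun_def intro!: r_into_rtranclp exI)
  from yields_add[OF this Suc] have "yields K (stack u (2 + 2 * k)) (stack v (1 + k))"
    by (simp only: stack_add)
  then show ?case by simp
qed

lemma can_pebble_yields:
  "yields K D E \<Longrightarrow> can_pebble K E v k \<Longrightarrow> can_pebble K D v k"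
  unfolding can_pebble_iff_yields by (rule yields_trans)

lemma can_pebble_mono:
  "E \<le> D \<Longrightarrow> can_pebble K E v k \<Longrightarrow> can_pebble K D v k"
  by (rule can_pebble_yields[OF yields_le])

lemma exists_sub_distribution:
  fixes A :: "'v \<Rightarrow> nat"
  assumes "finite V" "c \<le> sum A V"
  obtains B where "\<And>v. B v \<le> A v" "\<And>v. v \<notin> V \<Longrightarrow> B v = 0" "sum B V = c"
proof -
  have "\<exists>B. (\<forall>v. B v \<le> A v) \<and> (\<forall>v. v \<notin> V \<longrightarrow> B v = 0) \<and> sum B V = c"
    using assms
  proof (induction V arbitrary: c rule: finite_induct)
    case (insert x V)
    then have "c - min c (A x) \<le> sum A V" by auto
    from insert.IH[OF this] obtain B where
      B: "\<And>v. B v \<le> A v" "\<And>v. v \<notin> V \<Longrightarrow> B v = 0" "sum B V = c - min c (A x)"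
      by auto
    have "sum (B(x := min c (A x))) V = sum B V"
      using insert.hyps by (intro sum.cong) auto
    then show ?case
      using insert.hyps B by (intro exI[of _ "B(x := min c (A x))"]) auto
  qed (auto intro: exI[of _ "\<lambda>_. 0"])
  then show thesis using that by blast
qed

section \<open>Bounds on the pebbling number\<close>

definition pebbling_bound :: "'v pair_pre_digraph \<Rightarrow> nat \<Rightarrow> bool" where
  "pebbling_bound K p \<longleftrightarrow> (\<forall>D. pebbles K D = p \<longrightarrow> (\<forall>v\<in>pverts K. can_pebble K D v 1))"

lemma pebbling_number_eq: "pebbling_number K = (LEAST p. pebbling_bound K p)"
  by (simp add: pebbling_number_def pebbling_bound_def)

lemma pebbling_number_le: "pebbling_bound K p \<Longrightarrow> pebbling_number K \<le> p"
  by (simp add: pebbling_number_eq Least_le)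

text \<open>The definition speaks of exactly \<open>p\<close> pebbles; any surplus is set aside by
  passing to a smaller distribution.\<close>

lemma pebbling_bound_ge:
  assumes "finite (pverts K)" "pebbling_bound K p" "p \<le> pebbles K D" "v \<in> pverts K"
  shows "can_pebble K D v 1"
proof -
  obtain B where B: "\<And>v. B v \<le> D v" "pebbles K B = p"
    using exists_sub_distribution[OF assms(1), of p D] assms(3) by (auto simp: pebbles_def)
  then have "can_pebble K B v 1"
    using assms by (auto simp: pebbling_bound_def)
  then show ?thesis
    using can_pebble_mono[of B D] B by (auto simp: le_fun_def)
qed

text \<open>The existence of some bound \<open>p\<close> ensures that the \<open>LEAST\<close> in
  the definition is attained; an unsolvable distribution must then lie below it.\<close>

lemma less_pebbling_number:
  assumes "finite (pverts K)" "pebbling_bound K p" "v \<in> pverts K" "\<not> can_pebble K D v 1"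
  shows "pebbles K D < pebbling_number K"
proof (rule ccontr)
  have "pebbling_bound K (pebbling_number K)"
    unfolding pebbling_number_eq using assms(2) by (rule LeastI)
  moreover assume "\<not> pebbles K D < pebbling_number K"
  ultimately show False
    using pebbling_bound_ge[OF assms(1) _ _ assms(3)] assms(4) by (simp add: not_less)
qed

text \<open>At the vertices in \<open>S\<close> the potential counts only complete pairs of pebbles: a single pebble
  there cannot move.\<close>

lemma potential_bound:
  fixes w :: "'v \<Rightarrow> nat"
  assumes fin: "finite (pverts K)" and in_verts: "\<And>x y. (x, y) \<in> parcs K \<Longrightarrow> x \<in> pverts K \<and> y \<in> pverts K \<and> x \<noteq> y"
    and w: "\<And>x y. (x, y) \<in> parcs K \<Longrightarrow> w y \<le> 2 * w x"
    and wS: "\<And>x y. (x, y) \<in> parcs K \<Longrightarrow> y \<in> S \<Longrightarrow> x \<notin> S \<and> w y \<le> w x"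
    and v: "v \<in> pverts K" "v \<notin> S"
    and less: "(\<Sum>x\<in>pverts K. w x * (if x \<in> S then 2 * (D x div 2) else D x)) < w v"
  shows "\<not> can_pebble K D v 1"
proof
  define \<phi> where "\<phi> D = (\<Sum>x\<in>pverts K. w x * (if x \<in> S then 2 * (D x div 2) else D x))"
    for D :: "'v \<Rightarrow> nat"
  have move: "\<phi> D' \<le> \<phi> D" if "pebbling_move K D D'" for D D'
    using that
  proof cases
    case (1 x y)
    note xy = in_verts[OF 1(2)]
    let ?g = "\<lambda>D u. w u * (if u \<in> S then 2 * (D u div 2) else D u)"
    have split: "\<phi> E = ?g E x + (?g E y + (\<Sum>u\<in>pverts K - {x} - {y}. ?g E u))" for E
      unfolding \<phi>_def using fin xy sum.remove[OF fin, of x "?g E"]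
        sum.remove[of "pverts K - {x}" y "?g E"] by auto
    have rest: "(\<Sum>u\<in>pverts K - {x} - {y}. ?g D' u) = (\<Sum>u\<in>pverts K - {x} - {y}. ?g D u)"
      by (rule sum.cong) (auto simp: 1)
    have x: "?g D' x + 2 * w x = ?g D x"
    proof -
      have "D x = D' x + 2" using 1 xy by simp
      then show ?thesis by (auto simp: algebra_simps)
    qed
    \<comment> \<open>A pebble arriving in \<open>S\<close> may complete a pair worth
      \<open>2 * w y\<close>, while the move costs \<open>2 * w x\<close>; hence the stronger
      assumption \<open>w y \<le> w x\<close> there.\<close>
    have y: "?g D' y \<le> ?g D y + 2 * w x"
    proof -
      have y: "D' y = D y + 1" using 1 by simp
      show ?thesis
      proof (cases "y \<in> S")
        case True
        have "2 * (D' y div 2) \<le> 2 * (D y div 2) + 2" using y by auto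
        then have "w y * (2 * (D' y div 2)) \<le> w y * (2 * (D y div 2) + 2)" by (rule mult_left_mono) simp
        then show ?thesis using True wS[OF 1(2)] by (simp add: algebra_simps)
      next
        case False
        then show ?thesis using y w[OF 1(2)] by simp
      qed
    qed
    show ?thesis
      unfolding split[of D] split[of D'] rest using x y by linarith
  qed
  assume "can_pebble K D v 1"
  then obtain D' where D': "(pebbling_move K)\<^sup>*\<^sup>* D D'" "1 \<le> D' v"
    by (auto simp: can_pebble_def)
  from D'(1) have "\<phi> D' \<le> \<phi> D"
    by induction (auto dest: move)
  moreover have "w v \<le> \<phi> D'"
  proof -
    have "w v * 1 \<le> w v * D' v" using D'(2) by (intro mult_left_mono) auto
    also have "\<dots> \<le> \<phi> D'"
      unfolding \<phi>_def using member_le_sum[OF v(1) _ fin, of "\<lambda>x. w x * (if x \<in> S then 2 * (D' x div 2) else D' x)"] v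
      by auto
    finally show ?thesis by simp
  qed
  ultimately show False
    using less by (simp add: \<phi>_def)
qed

text \<open>One pebble on every vertex except the target admits no move at all.\<close>

lemma card_le_pebbling_number:
  assumes "finite (pverts K)" "pebbling_bound K p" "pverts K \<noteq> {}"
  shows "card (pverts K) \<le> pebbling_number K"
proof -
  obtain v where v: "v \<in> pverts K" using assms(3) by blast
  define D where "D = (\<lambda>x. if x = v then 0 else 1 :: nat)"
  have no_move: "\<not> pebbling_move K D D'" for D'
    by (auto simp: D_def elim!: pebbling_move.cases split: if_splits)
  have "D' = D" if "(pebbling_move K)\<^sup>*\<^sup>* D D'" for D'
    using that by (cases rule: converse_rtranclpE) (use no_move in auto)
  then have "\<not> can_pebble K D v 1"
    unfolding can_pebble_def by (force simp: D_def)
  moreover have "pebbles K D = card (pverts K) - 1"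
    using assms v by (auto simp: pebbles_def D_def sum.remove[of _ v])
  ultimately show ?thesis
    using less_pebbling_number[OF assms(1,2) v] assms by fastforce
qed

text \<open>Along a walk the required pile doubles at each arc, so a finite pile
  \<open>N u v\<close> on \<open>u\<close> always reaches \<open>v\<close>. With more pebbles than
  the sum of all these numbers, some vertex carries a sufficient pile.\<close>

lemma pebbling_bound_exists:
  assumes "pair_graph K" "connected (with_proj K)"
  shows "\<exists>p. pebbling_bound K p"
proof -
  interpret pair_graph K by fact
  have strong: "strongly_connected (with_proj K)"
    using symmetric_connected_imp_strongly_connected[OF _ assms(2)] pair_sym_arcs by auto
  have "\<exists>N. yields K (stack u N) (stack v 1)" if uv: "u \<in> pverts K" "v \<in> pverts K" for u v
  proof -
    have "u \<rightarrow>\<^sup>*\<^bsub>with_proj K\<^esub> v" using strong uv by auto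
    then show ?thesis
    proof (induction rule: converse_reachable_induct)
      case base
      then show ?case using yields_refl by blast
    next
      case (step x y)
      then obtain N where "yields K (stack y N) (stack v 1)" by auto
      moreover have "(x, y) \<in> parcs K" using step by (auto simp: arcs_ends_def arc_to_ends_def)
      ultimately have "yields K (stack x (2 * N)) (stack v 1)" by (rule yields_trans[OF yields_arc, rotated])
      then show ?case ..
    qed
  qed
  then obtain N where N: "\<And>u v. u \<in> pverts K \<Longrightarrow> v \<in> pverts K \<Longrightarrow> yields K (stack u (N u v)) (stack v 1)"
    by metis
  define p where "p = (\<Sum>v\<in>pverts K. \<Sum>u\<in>pverts K. N u v)"
  have "can_pebble K D v 1" if D: "pebbles K D = p + 1" and v: "v \<in> pverts K" for D v
  proof (rule ccontr)
    assume *: "\<not> can_pebble K D v 1"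
    have "D u \<le> N u v" if u: "u \<in> pverts K" for u
    proof (rule ccontr)
      assume "\<not> ?thesis"
      then have "stack u (N u v) \<le> D" by (auto simp: stack_def le_fun_def)
      then show False
        using N[OF u v] * yields_trans[OF yields_le] by (auto simp: can_pebble_iff_yields)
    qed
    then have "pebbles K D \<le> (\<Sum>u\<in>pverts K. N u v)" by (auto simp: pebbles_def intro: sum_mono)
    also have "\<dots> \<le> p"
      unfolding p_def using member_le_sum[OF v, of "\<lambda>v. \<Sum>u\<in>pverts K. N u v"] pair_finite_verts by auto
    finally show False using D by simp
  qed
  then show ?thesis by (auto simp: pebbling_bound_def)
qed

section \<open>Fibres of a product\<close>

lemma pebbles_eq_odd_plus_pairs:
  assumes "finite (pverts K)"
  shows "pebbles K A = card (odd_verts K A) + 2 * (\<Sum>v\<in>pverts K. A v div 2)"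
proof -
  have "pebbles K A = (\<Sum>v\<in>pverts K. A v mod 2 + 2 * (A v div 2))"
    by (simp add: pebbles_def)
  also have "\<dots> = (\<Sum>v\<in>pverts K. A v mod 2) + 2 * (\<Sum>v\<in>pverts K. A v div 2)"
    by (simp only: sum.distrib sum_distrib_left)
  also have "(\<Sum>v\<in>pverts K. A v mod 2) = (\<Sum>v\<in>pverts K. if v \<in> odd_verts K A then 1 else 0)"
    by (intro sum.cong) (auto simp: odd_verts_def odd_iff_mod_2_eq_one)
  also have "\<dots> = card (odd_verts K A)"
    using assms by (simp add: sum.If_cases odd_verts_def Int_def Collect_conj_eq[symmetric] conj_commute)
  finally show ?thesis .
qed

lemma even_pebbles_plus_odd:
  "finite (pverts K) \<Longrightarrow> even (pebbles K A + card (odd_verts K A))"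
  by (simp add: pebbles_eq_odd_plus_pairs[of K A])

lemma card_odd_verts_le: "finite (pverts K) \<Longrightarrow> card (odd_verts K A) \<le> card (pverts K)"
  by (auto simp: odd_verts_def intro!: card_mono)

text \<open>What is removed has the form \<open>B + B\<close>, so it can be halved into a
  neighbouring fibre or collected twice, and no parity changes.\<close>

lemma split_off_pairs:
  assumes "finite (pverts K)" "2 * c + card (odd_verts K A) \<le> pebbles K A"
  obtains A' B where "A = A' + (B + B)" "pebbles K B = c"
    "\<And>v. v \<notin> pverts K \<Longrightarrow> B v = 0"
    "pebbles K A' + 2 * c = pebbles K A" "odd_verts K A' = odd_verts K A"
proof -
  have "c \<le> (\<Sum>v\<in>pverts K. A v div 2)"
    using assms pebbles_eq_odd_plus_pairs[OF assms(1), of A] by simp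
  from exists_sub_distribution[OF assms(1) this] obtain B where
    B: "\<And>v. B v \<le> A v div 2" "\<And>v. v \<notin> pverts K \<Longrightarrow> B v = 0" "pebbles K B = c"
    by (auto simp: pebbles_def)
  define A' where "A' = (\<lambda>v. A v - 2 * B v)"
  have le: "2 * B v \<le> A v" for v
    using B(1)[of v] by auto
  have A: "A = A' + (B + B)"
    using le by (auto simp: A'_def fun_eq_iff algebra_simps mult_2[symmetric])
  have "odd (A' v) = odd (A v)" for v
    using le[of v] by (simp add: A'_def)
  then have "odd_verts K A' = odd_verts K A"
    by (simp add: odd_verts_def)
  moreover have "pebbles K A' + 2 * c = pebbles K A"
    unfolding A using B(3) by (simp add: pebbles_def sum.distrib)
  ultimately show thesis
    using that A B by blast
qed

text \<open>\<open>G\<close> enters only through a fixed target \<open>t\<close> and a number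
  \<open>f\<close> with the properties of its pebbling number; \<open>card_le\<close> is there to
  bound the number of odd vertices by \<open>f\<close>.\<close>

locale pebbling_product =
  fixes H :: "'h pair_pre_digraph" and G :: "'a pair_pre_digraph" and f :: nat and root :: 'h and t :: 'a
  assumes H: "pair_graph H" and G: "pair_graph G" and t: "t \<in> pverts G" and root: "root \<in> pverts H"
    and one: "\<And>A. f \<le> pebbles G A \<Longrightarrow> can_pebble G A t 1"
    and two: "\<And>A. 2 * f < pebbles G A + card (odd_verts G A) \<Longrightarrow> can_pebble G A t 2"
    and card_le: "card (pverts G) \<le> f"
begin

abbreviation p where "p A \<equiv> pebbles G A"
abbreviation r where "r A \<equiv> card (odd_verts G A)"
abbreviation HG where "HG \<equiv> cartesian_product H G"

lemma fin: "finite (pverts G)"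
  using pair_graphD(1)[OF G] .

lemma arc_verts: "(h, h') \<in> parcs H \<Longrightarrow> h \<in> pverts H \<and> h' \<in> pverts H \<and> h \<noteq> h'"
  using pair_graphD(2)[OF H] by blast

lemma r_le: "r A \<le> f"
  using card_odd_verts_le[OF fin] card_le le_trans by blast

definition fibre :: "'h \<Rightarrow> ('a \<Rightarrow> nat) \<Rightarrow> 'h \<times> 'a \<Rightarrow> nat" where
  "fibre h A = (\<lambda>(h', g). if h' = h then A g else 0)"

lemma fibre_add: "fibre h (A + B) = fibre h A + fibre h B"
  by (auto simp: fibre_def fun_eq_iff)

lemma fibre_stack: "fibre h (stack g k) = stack (h, g) k"
  by (auto simp: fibre_def stack_def fun_eq_iff)

lemma yields_fibre:
  assumes "yields G A B" "h \<in> pverts H"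
  shows "yields HG (fibre h A) (fibre h B)"
proof -
  have move: "pebbling_move HG (fibre h A) (fibre h A')" if "pebbling_move G A A'" for A A'
    using that
  proof cases
    case (1 u v)
    have "fibre h A' = (fibre h A)((h, u) := fibre h A (h, u) - 2, (h, v) := fibre h A (h, v) + 1)"
      using 1 by (auto simp: fibre_def fun_eq_iff)
    moreover have "((h, u), (h, v)) \<in> parcs HG"
      using 1 assms(2) by (auto simp: cartesian_product_def)
    ultimately show ?thesis
      using pebbling_move.intros[of "(h, u)" "(h, v)" HG "fibre h A"] 1 by (simp add: fibre_def)
  qed
  obtain B' where B': "(pebbling_move G)\<^sup>*\<^sup>* A B'" "B \<le> B'"
    using assms by (auto simp: yields_def)
  from B'(1) have "(pebbling_move HG)\<^sup>*\<^sup>* (fibre h A) (fibre h B')"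
    by induction (auto intro: rtranclp.rtrancl_into_rtrancl move)
  then show ?thesis
    using B'(2) by (auto simp: yields_def fibre_def le_fun_def)
qed

text \<open>Each fibre distribution is a sum of piles on single vertices, and every pile crosses
  along its own arc. \<open>B\<close> vanishes off the vertex set because there are no arcs
  there.\<close>

lemma yields_across:
  assumes "(h, h') \<in> parcs H" and B: "\<And>g. g \<notin> pverts G \<Longrightarrow> B g = 0"
  shows "yields HG (fibre h (B + B)) (fibre h' B)"
proof -
  have eq: "fibre k C = (\<Sum>g\<in>pverts G. stack (k, g) (C g))" if "\<And>g. g \<notin> pverts G \<Longrightarrow> C g = 0"
    for k and C :: "'a \<Rightarrow> nat"
  proof
    fix y :: "'h \<times> 'a"
    obtain k' g' where y: "y = (k', g')" by (cases y)
    have "(\<Sum>g\<in>pverts G. stack (k, g) (C g)) y = (\<Sum>g\<in>pverts G. if g' = g then (if k' = k then C g else 0) else 0)"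
      by (auto simp: y sum_fun_apply stack_def intro!: sum.cong)
    also have "\<dots> = fibre k C y"
      using fin that by (auto simp: y fibre_def)
    finally show "fibre k C y = (\<Sum>g\<in>pverts G. stack (k, g) (C g)) y" ..
  qed
  have "yields HG (\<Sum>g\<in>pverts G. stack (h, g) (2 * B g)) (\<Sum>g\<in>pverts G. stack (h', g) (B g))"
    using assms by (intro yields_sum yields_arc) (auto simp: cartesian_product_def)
  then show ?thesis
    using eq[of "B + B" h] eq[of B h'] B by (simp add: mult_2)
qed

lemma collect_one:
  assumes "f \<le> p A"
  obtains A' where "p A' + f = p A" "yields G A (A' + stack t 1)"
proof -
  obtain B where B: "\<And>v. B v \<le> A v" "pebbles G B = f"
    using exists_sub_distribution[OF fin, of f A] assms by (auto simp: pebbles_def)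
  define A' where "A' = (\<lambda>v. A v - B v)"
  have A: "A = B + A'"
    using B(1) by (auto simp: A'_def fun_eq_iff)
  have "yields G B (stack t 1)"
    using one[of B] B(2) by (simp add: can_pebble_iff_yields)
  from yields_add_right[OF this, of A'] show thesis
    using that[of A'] A B(2) by (simp add: add.commute pebbles_def sum.distrib)
qed

text \<open>A collection of \<open>2 f\<close> pebbles in pairs splits into two equal collections of \<open>f\<close> pebbles; removing
  it does not change the parities.\<close>

lemma collect_even:
  assumes "2 * k * f < p A + r A"
  shows "yields G A (stack t (2 * k))"
  using assms
proof (induction k arbitrary: A)
  case 0
  then show ?case by (simp add: yields_le le_fun_def)
next
  case (Suc k)
  show ?case
  proof (cases "k = 0")
    case True
    then show ?thesis using Suc.prems two[of A] by (simp add: can_pebble_iff_yields)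
  next
    case False
    \<comment> \<open>As \<open>r A \<le> f\<close>, the hypothesis gives
      \<open>p A > 4 * f - r A \<ge> 2 * f + r A\<close>, so \<open>f\<close> whole pairs are
      available.\<close>
    have "2 * f + 2 * f \<le> 2 * Suc k * f" using False by (cases k) auto
    then have "2 * f + r A \<le> p A"
      using Suc.prems r_le[of A] by linarith
    then obtain A' B where AB: "A = A' + (B + B)" "p B = f"
      "p A' + 2 * f = p A" "odd_verts G A' = odd_verts G A"
      by (rule split_off_pairs[OF fin]) blast
    have "yields G A' (stack t (2 * k))"
    proof (rule Suc.IH)
      have "2 * Suc k * f = 2 * k * f + 2 * f" by simp
      then show "2 * k * f < p A' + r A'"
        using Suc.prems AB(3) unfolding AB(4) by linarith
    qed
    moreover have "yields G B (stack t 1)"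
      using one[of B] AB by (simp add: can_pebble_iff_yields)
    ultimately have "yields G A (stack t (2 * k) + (stack t 1 + stack t 1))"
      unfolding AB(1) by (intro yields_add)
    then show ?thesis
      by (simp add: stack_add[symmetric])
  qed
qed

section \<open>Configurations with gathered pebbles\<close>

text \<open>\<open>D h\<close> is the distribution on the fibre over \<open>h\<close>; \<open>J h\<close> further pebbles have been gathered at
  \<open>(h, t)\<close> and are kept apart, so that they do not enter the parities of \<open>D h\<close>.\<close>

definition config :: "('h \<Rightarrow> 'a \<Rightarrow> nat) \<Rightarrow> ('h \<Rightarrow> nat) \<Rightarrow> 'h \<times> 'a \<Rightarrow> nat" where
  "config D J = (\<lambda>(h, g). D h g + (if g = t then J h else 0))"

definition solv :: "('h \<Rightarrow> 'a \<Rightarrow> nat) \<Rightarrow> ('h \<Rightarrow> nat) \<Rightarrow> bool" where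
  "solv D J \<longleftrightarrow> can_pebble HG (config D J) (root, t) 1"

lemma solv_yields: "yields HG (config D J) (config D' J') \<Longrightarrow> solv D' J' \<Longrightarrow> solv D J"
  unfolding solv_def by (rule can_pebble_yields)

lemma solv_mono:
  assumes "solv D' J'" "\<And>h g. D' h g \<le> D h g" "\<And>h. J' h \<le> J h"
  shows "solv D J"
  using assms(1) by (rule solv_yields[rotated]) (auto intro!: yields_le add_mono simp: config_def le_fun_def assms)

lemma config_update:
  assumes "D h = A + B" "J h = i + k"
  shows "config D J = config (D(h := A)) (J(h := i)) + (fibre h B + stack (h, t) k)"
  using assms by (auto simp: config_def fibre_def stack_def fun_eq_iff)

lemma config_update':
  "config (D(h := A + B)) (J(h := i + k)) = config (D(h := A)) (J(h := i)) + (fibre h B + stack (h, t) k)"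
  by (auto simp: config_def fibre_def stack_def fun_eq_iff)

lemma solv_collect:
  assumes "yields G (D h) (A + stack t k)" "h \<in> pverts H"
    and "solv (D(h := A)) (J(h := J h + k))"
  shows "solv D J"
proof (rule solv_yields[OF _ assms(3)])
  have "yields HG (config (D(h := 0)) J + fibre h (D h)) (config (D(h := 0)) J + fibre h (A + stack t k))"
    using yields_add[OF yields_refl yields_fibre[OF assms(1,2)]] .
  then show "yields HG (config D J) (config (D(h := A)) (J(h := J h + k)))"
    using config_update[of D h 0 "D h" J "J h" 0] config_update'[of D h 0 A J "J h" k]
    by (simp add: fibre_add fibre_stack fun_upd_idem)
qed

lemma solv_move:
  assumes "(h, h') \<in> parcs H" "2 * k \<le> J h" "solv D (J(h := J h - 2 * k, h' := J h' + k))"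
  shows "solv D J"
proof (rule solv_yields[OF _ assms(3)])
  have "h \<noteq> h'" using arc_verts assms by blast
  then have 1: "config D J = config D (J(h := J h - 2 * k)) + stack (h, t) (2 * k)"
    and 2: "config D (J(h := J h - 2 * k, h' := J h' + k)) = config D (J(h := J h - 2 * k)) + stack (h', t) k"
    using assms(2) by (auto simp: config_def stack_def fun_eq_iff)
  have "((h, t), (h', t)) \<in> parcs HG"
    using assms(1) t by (auto simp: cartesian_product_def)
  then show "yields HG (config D J) (config D (J(h := J h - 2 * k, h' := J h' + k)))"
    unfolding 1 2 by (intro yields_add yields_refl yields_arc)
qed

lemma solv_collect_one:
  assumes "f \<le> p (D h)" "h \<in> pverts H"
  obtains A where "p A + f = p (D h)" "\<And>J. solv (D(h := A)) (J(h := J h + 1)) \<Longrightarrow> solv D J"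
proof -
  obtain A where "p A + f = p (D h)" "yields G (D h) (A + stack t 1)"
    using collect_one[OF assms(1)] .
  then show thesis
    using that solv_collect[OF _ assms(2)] by blast
qed

text \<open>After gathering \<open>2 * k\<close> pebbles the rest of the fibre over \<open>h\<close>
  is abandoned. Admitting \<open>k = 0\<close> covers fibres from which nothing can be
  gathered.\<close>

lemma solv_collect_move:
  assumes arc: "(h, h') \<in> parcs H" and k: "2 * k * f < p (D h) + r (D h) \<or> k = 0"
    and "solv (D(h := 0)) (J(h' := J h' + k))"
  shows "solv D J"
proof (cases "k = 0")
  case True
  then show ?thesis by (intro solv_mono[OF assms(3)]) auto
next
  case False
  have "h \<noteq> h'" "h \<in> pverts H" using arc_verts[OF arc] by auto
  from False k collect_even have "yields G (D h) (0 + stack t (2 * k))" by simp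
  moreover have "solv (D(h := 0)) (J(h := J h + 2 * k))"
    by (rule solv_move[OF arc, of k]) (use assms(3) \<open>h \<noteq> h'\<close> in \<open>auto simp: fun_upd_twist\<close>)
  ultimately show ?thesis
    using solv_collect[OF _ \<open>h \<in> pverts H\<close>] by blast
qed

text \<open>Parities over \<open>h\<close> survive, so a later collection from \<open>h\<close>
  still profits from \<open>r\<close>; over \<open>h'\<close> only the number of pebbles is
  controlled.\<close>

lemma transfer:
  assumes arc: "(h, h') \<in> parcs H" and c: "2 * c + r (D h) \<le> p (D h)"
  obtains D' where "\<And>k. k \<noteq> h \<Longrightarrow> k \<noteq> h' \<Longrightarrow> D' k = D k"
    "p (D' h) + 2 * c = p (D h)" "r (D' h) = r (D h)" "p (D' h') = p (D h') + c"
    "\<And>J. solv D' J \<Longrightarrow> solv D J"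
proof -
  obtain A B where AB: "D h = A + (B + B)" "p B = c" "\<And>v. v \<notin> pverts G \<Longrightarrow> B v = 0"
    "p A + 2 * c = p (D h)" "odd_verts G A = odd_verts G (D h)"
    using split_off_pairs[OF fin c] by metis
  have "h \<noteq> h'" using arc_verts[OF arc] by auto
  define D' where "D' = D(h := A, h' := D h' + B)"
  have "yields HG (config D J) (config D' J)" for J
  proof -
    have 1: "config D J = config (D(h := A)) J + fibre h (B + B)"
      using config_update[of D h A "B + B" J "J h" 0] AB by simp
    have 2: "config D' J = config (D(h := A)) J + fibre h' B"
      using \<open>h \<noteq> h'\<close> by (auto simp: D'_def config_def fibre_def fun_eq_iff)
    show ?thesis
      unfolding 1 2 using AB(3) by (intro yields_add yields_refl yields_across[OF arc])
  qed
  then have "\<And>J. solv D' J \<Longrightarrow> solv D J"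
    using solv_yields by blast
  moreover have "p (D' h') = p (D h') + c"
    using AB(2) by (simp add: D'_def pebbles_def sum.distrib)
  moreover have "D' h = A"
    using \<open>h \<noteq> h'\<close> by (simp add: D'_def)
  ultimately show thesis
    using that[of D'] AB(4,5) by (simp add: D'_def)
qed

lemma solv_root: "1 \<le> J root \<Longrightarrow> solv D J"
  by (auto simp: solv_def can_pebble_iff_yields config_def stack_def le_fun_def intro!: yields_le)

lemma solv_root_fibre:
  assumes "f \<le> p (D root)"
  shows "solv D J"
proof -
  obtain A where "\<And>J. solv (D(root := A)) (J(root := J root + 1)) \<Longrightarrow> solv D J"
    using solv_collect_one[of D root, OF assms root] by metis
  then show ?thesis by (simp add: solv_root)
qed

text \<open>\<open>k\<close> is the largest number of pairs that \<open>collect_even\<close> is able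
  to gather. It exists because \<open>f\<close> is positive, \<open>G\<close> having the vertex
  \<open>t\<close>.\<close>

lemma collectable_exists:
  obtains k where "2 * k * f < p A + r A \<or> k = 0" "p A + r A \<le> 2 * (k + 1) * f"
proof -
  have "\<exists>k. p A + r A \<le> 2 * (k + 1) * f"
  proof -
    have "f \<noteq> 0" using card_le t fin by (metis card_eq_0_iff empty_iff le_zero_eq)
    then have "p A + r A \<le> (p A + r A) * f" by (cases f) auto
    then show ?thesis
      by (intro exI[of _ "p A + r A"]) (simp add: algebra_simps)
  qed
  then obtain k where k: "p A + r A \<le> 2 * (k + 1) * f" "\<And>i. i < k \<Longrightarrow> \<not> p A + r A \<le> 2 * (i + 1) * f"
    using exists_least_iff[of "\<lambda>k. p A + r A \<le> 2 * (k + 1) * f"] by auto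
  show thesis
    using that[of k] k(1) k(2)[of "k - 1"] by (cases k) auto
qed

lemma even_p_r: "even (p A + r A)"
  by (rule even_pebbles_plus_odd[OF fin])

lemma r_le_p: "r A \<le> p A"
  using pebbles_eq_odd_plus_pairs[OF fin, of A] by simp

text \<open>Moving all \<open>(p - r) / 2\<close> pairs costs \<open>(p + r) / 2\<close> pebbles,
  the same quantity \<open>p + r\<close> that decides whether gathering succeeds.\<close>

lemma transfer_all:
  assumes arc: "(h, h') \<in> parcs H" and "p (D h) + r (D h) \<le> 2 * N"
  obtains D' where "\<And>k. k \<noteq> h \<Longrightarrow> k \<noteq> h' \<Longrightarrow> D' k = D k" "p (D h') + p (D h) \<le> p (D' h') + N"
    "\<And>J. solv D' J \<Longrightarrow> solv D J"
proof -
  define c where "c = (p (D h) - r (D h)) div 2"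
  have c: "2 * c + r (D h) = p (D h)"
    using even_p_r[of "D h"] r_le_p[of "D h"] by (auto simp: c_def)
  then obtain D' where D': "\<And>k. k \<noteq> h \<Longrightarrow> k \<noteq> h' \<Longrightarrow> D' k = D k" "p (D' h') = p (D h') + c"
    "\<And>J. solv D' J \<Longrightarrow> solv D J"
    using transfer[OF arc, of c D] by (metis order_refl)
  have "p (D h') + p (D h) \<le> p (D' h') + N"
    using D'(2) c assms(2) by linarith
  then show thesis
    using that[of D'] D' by blast
qed

end

section \<open>Ladders\<close>

text \<open>Level \<open>Suc i\<close> consists of \<open>x (Suc i)\<close> and possibly
  \<open>z (Suc i)\<close>, both adjacent to \<open>x i\<close>. The arc from
  \<open>z (Suc i)\<close> to \<open>x (Suc i)\<close> serves to adjust the number of pebbles within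
  a level.\<close>

locale ladder = pebbling_product H G f root t
  for H :: "'h pair_pre_digraph" and G :: "'a pair_pre_digraph" and f :: nat and root :: 'h and t :: 'a +
  fixes x z :: "nat \<Rightarrow> 'h" and S :: "nat set" and m :: nat
  assumes x_0: "x 0 = root"
    and arc_x: "\<And>i. i < m \<Longrightarrow> (x (Suc i), x i) \<in> parcs H"
    and arc_z: "\<And>i. i < m \<Longrightarrow> Suc i \<in> S \<Longrightarrow> (z (Suc i), x i) \<in> parcs H \<and> (z (Suc i), x (Suc i)) \<in> parcs H"
    and S: "S \<subseteq> {1..m}"
    and inj_x: "inj_on x {..m}"
    and inj_z: "inj_on z S"
    and z_neq_x: "\<And>i j. i \<in> S \<Longrightarrow> j \<le> m \<Longrightarrow> z i \<noteq> x j"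
begin

definition e where "e i = (if i \<in> S then 1 else 0 :: nat)"
definition pz where "pz D i = (if i \<in> S then p (D (z i)) else 0)"
text \<open>The sum starts at 1: the fibre over the root will be shared by two ladders and is
  counted separately.\<close>

definition tot where "tot i D = (\<Sum>k=1..i. p (D (x k)) + pz D k)"
definition E where "E i = (\<Sum>k=1..i. e k)"

lemma tot_0 [simp]: "tot 0 D = 0" and tot_Suc: "tot (Suc i) D = tot i D + p (D (x (Suc i))) + pz D (Suc i)"
  by (auto simp: tot_def)

lemma E_0 [simp]: "E 0 = 0" and E_Suc: "E (Suc i) = E i + e (Suc i)"
  by (auto simp: E_def)

text \<open>The vertices whose fibres may change when level \<open>Suc i\<close> is emptied into
  \<open>x i\<close>.\<close>

definition lev where "lev i = {x (Suc i), x i} \<union> z ` ({Suc i} \<inter> S)"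
definition rungs where "rungs i = x ` {..i} \<union> z ` ({..i} \<inter> S)"

lemma x_eq_iff: "i \<le> m \<Longrightarrow> j \<le> m \<Longrightarrow> x i = x j \<longleftrightarrow> i = j"
  using inj_x by (auto simp: inj_on_def)

lemma z_eq_iff: "i \<in> S \<Longrightarrow> j \<in> S \<Longrightarrow> z i = z j \<longleftrightarrow> i = j"
  using inj_z by (auto simp: inj_on_def)

lemma lev_subset: "lev i \<subseteq> rungs (Suc i)" and rungs_subset: "rungs i \<subseteq> rungs (Suc i)"
  by (auto simp: lev_def rungs_def)

text \<open>Among the fibres counted by \<open>tot i\<close>, only the one over \<open>x i\<close>
  can change. For \<open>i = 0\<close> that fibre is the root's and lies outside \<open>tot\<close>,
  hence the second version.\<close>

lemma tot_change:
  assumes "Suc i \<le> m" "\<And>k. k \<notin> lev i \<Longrightarrow> D' k = D k" "p (D (x i)) + c \<le> p (D' (x i)) + d"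
  shows "1 \<le> i \<Longrightarrow> tot i D + c \<le> tot i D' + d"
    and "p (D root) + tot i D + c \<le> p (D' root) + tot i D' + d"
proof -
  have x: "D' (x k) = D (x k)" if "k < i" for k
    using assms(1) that by (intro assms(2)) (auto simp: lev_def x_eq_iff z_neq_x[symmetric])
  have z: "pz D' k = pz D k" if "k \<le> i" for k
  proof (cases "k \<in> S")
    case True
    then have "z k \<notin> lev i" using assms(1) that by (auto simp: lev_def z_eq_iff z_neq_x)
    then show ?thesis by (simp add: pz_def assms(2))
  qed (simp add: pz_def)
  show *: "tot i D + c \<le> tot i D' + d" if i: "1 \<le> i"
  proof -
    obtain i' where i': "i = Suc i'" using i by (cases i) auto
    have "tot i' D' = tot i' D"
      unfolding tot_def using x z i' by (intro sum.cong) auto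
    then show ?thesis
      using assms(3) z[of i] by (simp add: i' tot_Suc)
  qed
  show "p (D root) + tot i D + c \<le> p (D' root) + tot i D' + d"
  proof (cases "i = 0")
    case True
    then show ?thesis using assms(3) x_0 by simp
  next
    case False
    then show ?thesis using * x[of 0] x_0 by simp
  qed
qed

lemma walk: "i \<le> m \<Longrightarrow> 2 ^ i \<le> J (x i) \<Longrightarrow> solv D J"
proof (induction i arbitrary: J)
  case 0
  then show ?case using solv_root[of J D] x_0 by simp
next
  case (Suc i)
  show ?case
  proof (rule solv_move[of _ _ "2 ^ i"])
    show "(x (Suc i), x i) \<in> parcs H" using Suc.prems by (intro arc_x) simp
    show "solv D (J(x (Suc i) := J (x (Suc i)) - 2 * 2 ^ i, x i := J (x i) + 2 ^ i))"
      using Suc.prems by (intro Suc.IH) auto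
  qed (use Suc.prems in simp)
qed

text \<open>The basic dichotomy, with a free threshold \<open>N\<close>: either few pebbles can be
  gathered from the level, and then emptying it is cheap, or \<open>N\<close> of them reach
  \<open>x i\<close> and complete the \<open>2 ^ i\<close> that can walk to the root.\<close>

lemma level:
  assumes i: "Suc i \<le> m"
  obtains D' where "\<And>k. k \<notin> lev i \<Longrightarrow> D' k = D k"
    "p (D (x i)) + p (D (x (Suc i))) + pz D (Suc i) \<le> p (D' (x i)) + (N + e (Suc i)) * f"
    "\<And>J. solv D' J \<Longrightarrow> solv D J"
  | "\<And>J. 2 ^ i \<le> J (x i) + N \<Longrightarrow> solv D J"
proof -
  have ax: "(x (Suc i), x i) \<in> parcs H" using i by (intro arc_x) simp
  have wk: "solv D' (J(x i := J (x i) + k))" if "2 ^ i \<le> J (x i) + k" for D' J k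
    using that i by (intro walk[of i]) auto
  show thesis
  proof (cases "Suc i \<in> S")
    case False
    show thesis
    proof (cases "p (D (x (Suc i))) + r (D (x (Suc i))) \<le> 2 * (N * f)")
      case True
      then obtain D' where "\<And>k. k \<noteq> x (Suc i) \<Longrightarrow> k \<noteq> x i \<Longrightarrow> D' k = D k"
        "p (D (x i)) + p (D (x (Suc i))) \<le> p (D' (x i)) + N * f" "\<And>J. solv D' J \<Longrightarrow> solv D J"
        using transfer_all[OF ax] by metis
      then show thesis
        using that(1)[of D'] False by (auto simp: lev_def pz_def e_def)
    next
      case False
      have "solv D J" if "2 ^ i \<le> J (x i) + N" for J
        by (rule solv_collect_move[OF ax, of N]) (use wk[of J N "D(x (Suc i) := 0)"] that False in auto)
      then show thesis by (rule that(2))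
    qed
  next
    case True
    then have az: "(z (Suc i), x i) \<in> parcs H" and neq: "z (Suc i) \<noteq> x i" "z (Suc i) \<noteq> x (Suc i)"
      using arc_z[of i] i z_neq_x[of "Suc i"] by auto
    obtain kx where kx: "2 * kx * f < p (D (x (Suc i))) + r (D (x (Suc i))) \<or> kx = 0"
      "p (D (x (Suc i))) + r (D (x (Suc i))) \<le> 2 * (kx + 1) * f"
      by (rule collectable_exists)
    obtain kz where kz: "2 * kz * f < p (D (z (Suc i))) + r (D (z (Suc i))) \<or> kz = 0"
      "p (D (z (Suc i))) + r (D (z (Suc i))) \<le> 2 * (kz + 1) * f"
      by (rule collectable_exists)
    show thesis
    proof (cases "kx + kz < N")
      case less: True
      have "p (D (x (Suc i))) + r (D (x (Suc i))) \<le> 2 * ((kx + 1) * f)"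
        using kx(2) by (simp only: mult.assoc)
      from transfer_all[of _ _ D, OF ax this] obtain D1 where
        D1: "\<And>k. k \<noteq> x (Suc i) \<Longrightarrow> k \<noteq> x i \<Longrightarrow> D1 k = D k"
        "p (D (x i)) + p (D (x (Suc i))) \<le> p (D1 (x i)) + (kx + 1) * f" "\<And>J. solv D1 J \<Longrightarrow> solv D J"
        by metis
      have z: "D1 (z (Suc i)) = D (z (Suc i))" using D1(1) neq by blast
      have "p (D1 (z (Suc i))) + r (D1 (z (Suc i))) \<le> 2 * ((kz + 1) * f)"
        using kz(2) unfolding z by (simp only: mult.assoc)
      from transfer_all[of _ _ D1, OF az this] obtain D2 where
        D2: "\<And>k. k \<noteq> z (Suc i) \<Longrightarrow> k \<noteq> x i \<Longrightarrow> D2 k = D1 k"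
        "p (D1 (x i)) + p (D1 (z (Suc i))) \<le> p (D2 (x i)) + (kz + 1) * f" "\<And>J. solv D2 J \<Longrightarrow> solv D1 J"
        by metis
      \<comment> \<open>A second fibre in the level costs only one additional \<open>f\<close>,
        because \<open>kx + kz < N\<close> bounds the two thresholds together.\<close>
      have "(kx + 1) * f + (kz + 1) * f \<le> (N + 1) * f"
        using less unfolding add_mult_distrib[symmetric] by (intro mult_le_mono1) simp
      then have "p (D (x i)) + p (D (x (Suc i))) + pz D (Suc i) \<le> p (D2 (x i)) + (N + e (Suc i)) * f"
        using D1(2) D2(2) True unfolding z by (simp add: pz_def e_def)
      then show thesis
        using that(1)[of D2] D1 D2 True by (auto simp: lev_def)
    next
      case False
      have "solv D J" if J: "2 ^ i \<le> J (x i) + N" for J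
      proof (rule solv_collect_move[where D = D and k = kx, OF ax kx(1)], rule solv_collect_move[OF az])
        show "2 * kz * f < p ((D(x (Suc i) := 0)) (z (Suc i))) + r ((D(x (Suc i) := 0)) (z (Suc i))) \<or> kz = 0"
          using kz(1) neq by simp
        show "solv (D(x (Suc i) := 0, z (Suc i) := 0)) ((J(x i := J (x i) + kx))(x i := (J(x i := J (x i) + kx)) (x i) + kz))"
          using J False by (intro wk) auto
      qed
      then show thesis by (rule that(2))
    qed
  qed
qed

text \<open>Applying \<open>level\<close> with \<open>N = 2 ^ i\<close> on each level, the losses
  add up to \<open>(2 ^ i - 1 + E i) * f\<close>; the \<open>- 1\<close> appears as
  \<open>+ f\<close> on the left. If gathering succeeds on some level, it alone supplies all the
  pebbles for the walk, whatever \<open>J\<close> is.\<close>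

lemma loss:
  assumes "i \<le> m"
  shows "(\<forall>J. solv D J) \<or> (\<exists>D'. (\<forall>k. k \<notin> rungs i \<longrightarrow> D' k = D k)
    \<and> p (D root) + tot i D + f \<le> p (D' root) + (2 ^ i + E i) * f \<and> (\<forall>J. solv D' J \<longrightarrow> solv D J))"
  using assms
proof (induction i arbitrary: D)
  case 0
  then show ?case by auto
next
  case (Suc i)
  show ?case
    using Suc.prems
  proof (rule level[where N = "2 ^ i" and D = D])
    fix D1
    assume D1: "\<And>k. k \<notin> lev i \<Longrightarrow> D1 k = D k"
      "p (D (x i)) + p (D (x (Suc i))) + pz D (Suc i) \<le> p (D1 (x i)) + (2 ^ i + e (Suc i)) * f"
      "\<And>J. solv D1 J \<Longrightarrow> solv D J"
    have step: "p (D root) + tot (Suc i) D \<le> p (D1 root) + tot i D1 + (2 ^ i + e (Suc i)) * f"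
      using tot_change(2)[of i D1 D "p (D (x (Suc i))) + pz D (Suc i)"] D1 Suc.prems
      by (simp add: tot_Suc add.assoc)
    have "i \<le> m" using Suc.prems by simp
    from Suc.IH[OF this, of D1] show ?thesis
    proof
      assume "\<exists>D'. (\<forall>k. k \<notin> rungs i \<longrightarrow> D' k = D1 k)
        \<and> p (D1 root) + tot i D1 + f \<le> p (D' root) + (2 ^ i + E i) * f \<and> (\<forall>J. solv D' J \<longrightarrow> solv D1 J)"
      then obtain D' where D': "\<And>k. k \<notin> rungs i \<Longrightarrow> D' k = D1 k"
        "p (D1 root) + tot i D1 + f \<le> p (D' root) + (2 ^ i + E i) * f" "\<And>J. solv D' J \<Longrightarrow> solv D1 J"
        by blast
      have "(2 ^ Suc i + E (Suc i)) * f = (2 ^ i + E i) * f + (2 ^ i + e (Suc i)) * f"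
        by (simp add: E_Suc algebra_simps)
      then have "p (D root) + tot (Suc i) D + f \<le> p (D' root) + (2 ^ Suc i + E (Suc i)) * f"
        using step D'(2) by linarith
      moreover have "D' k = D k" if "k \<notin> rungs (Suc i)" for k
      proof -
        have "k \<notin> rungs i" "k \<notin> lev i"
          using that lev_subset[of i] rungs_subset[of i] by blast+
        then show ?thesis using D'(1) D1(1) by simp
      qed
      ultimately show ?thesis
        using D'(3) D1(3) by blast
    qed (use D1(3) in blast)
  next
    assume "\<And>J. 2 ^ i \<le> J (x i) + 2 ^ i \<Longrightarrow> solv D J"
    then show ?thesis by simp
  qed
qed

section \<open>Ladders with gathered pebbles at the far end\<close>

text \<open>The bound \<open>2 * j \<le> 2 ^ i\<close> cannot be dropped: with more gathered pebbles the remaining ones may be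
  too few and too spread out.\<close>

definition reserve_ok where
  "reserve_ok i \<longleftrightarrow> (\<forall>D J j. 2 * j \<le> 2 ^ i \<longrightarrow> (2 ^ i + E i) * f \<le> tot i D + j * f \<longrightarrow> j \<le> J (x i) \<longrightarrow> solv D J)"

lemma reserve_okD:
  "reserve_ok i \<Longrightarrow> 2 * j \<le> 2 ^ i \<Longrightarrow> (2 ^ i + E i) * f \<le> tot i D + j * f \<Longrightarrow> j \<le> J (x i) \<Longrightarrow> solv D J"
  by (auto simp: reserve_ok_def)

text \<open>An even reserve advances without waste: half of it arrives at \<open>x i\<close>, and
  the threshold for \<open>level\<close> drops by exactly that amount.\<close>

lemma reserve_even:
  assumes i: "Suc i \<le> m" and IH: "1 \<le> i \<Longrightarrow> reserve_ok i"
    and l: "4 * l \<le> 2 ^ Suc i" and tot: "(2 ^ Suc i + E (Suc i)) * f \<le> tot (Suc i) D + 2 * l * f"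
    and J: "2 * l \<le> J (x (Suc i))"
  shows "solv D J"
proof (rule solv_move[of "x (Suc i)" "x i" l J])
  define J' where "J' = J(x (Suc i) := J (x (Suc i)) - 2 * l, x i := J (x i) + l)"
  have J': "l \<le> J' (x i)" by (simp add: J'_def)
  define N :: nat where "N = 2 ^ i - l"
  have N: "N + l = 2 ^ i" using l by (simp add: N_def)
  have Nf: "N * f + l * f = 2 ^ i * f" using N by (metis add_mult_distrib)
  have "solv D J'"
    using i
  proof (rule level[where N = N and D = D])
    fix D1
    assume D1: "\<And>k. k \<notin> lev i \<Longrightarrow> D1 k = D k"
      "p (D (x i)) + p (D (x (Suc i))) + pz D (Suc i) \<le> p (D1 (x i)) + (N + e (Suc i)) * f"
      "\<And>J. solv D1 J \<Longrightarrow> solv D J"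
    show ?thesis
    proof (cases "i = 0")
      case True
      \<comment> \<open>On the last level the reserve is empty, and emptying the level must leave
        \<open>f\<close> pebbles over the root.\<close>
      then have "l = 0" using l by simp
      then have "f \<le> p (D1 (x i))"
        using True D1(2) tot N by (simp add: tot_Suc E_Suc algebra_simps)
      then show ?thesis
        using True x_0 D1(3) solv_root_fibre by metis
    next
      case False
      then have i1: "1 \<le> i" by simp
      have "tot (Suc i) D \<le> tot i D1 + (N + e (Suc i)) * f"
        using tot_change(1)[of i D1 D "p (D (x (Suc i))) + pz D (Suc i)"] D1(1,2) i i1
        by (simp add: tot_Suc add.assoc)
      then have "(2 ^ i + E i) * f \<le> tot i D1 + l * f"
        using tot Nf by (simp add: E_Suc algebra_simps)
      then show ?thesis
        using l J' by (intro D1(3) reserve_okD[OF IH[OF i1], of l]) auto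
    qed
  next
    assume "\<And>J. 2 ^ i \<le> J (x i) + N \<Longrightarrow> solv D J"
    then show ?thesis using N J' by simp
  qed
  then show "solv D (J(x (Suc i) := J (x (Suc i)) - 2 * l, x i := J (x i) + l))"
    by (simp only: J'_def)
qed (use i J arc_x in auto)

text \<open>Moving an odd reserve wastes a pebble. So one more is gathered over
  \<open>x (Suc i)\<close> if possible, perhaps with help from \<open>z (Suc i)\<close>; if not, so
  few pebbles are tied up in the level that the waste is affordable.\<close>

lemma reserve_odd:
  assumes i: "Suc i \<le> m" and IH: "1 \<le> i \<Longrightarrow> reserve_ok i"
    and l: "2 * (2 * l + 1) \<le> 2 ^ Suc i" and tot: "(2 ^ Suc i + E (Suc i)) * f \<le> tot (Suc i) D + (2 * l + 1) * f"
    and J: "2 * l + 1 \<le> J (x (Suc i))"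
  shows "solv D J"
proof -
  let ?x = "x (Suc i)" and ?z = "z (Suc i)"
  have ax: "(?x, x i) \<in> parcs H" using i by (intro arc_x) simp
  have x_verts: "?x \<in> pverts H" using arc_verts[OF ax] by simp
  have x_neq: "?x \<noteq> x i" using arc_verts[OF ax] by simp
  have l0: "l = 0" if "i = 0" using l that by simp
  \<comment> \<open>For \<open>1 \<le> i\<close> the power \<open>2 ^ i\<close> is even and
    \<open>2 * l + 1\<close> is odd, so the bound leaves room for one more gathered pebble.\<close>
  have l1: "2 * (l + 1) \<le> 2 ^ i" "4 * (l + 1) \<le> 2 ^ Suc i" if i1: "1 \<le> i"
  proof -
    obtain i' where "i = Suc i'" using i1 by (cases i) auto
    moreover define q :: nat where "q = 2 ^ i'"
    ultimately have q: "2 ^ i = 2 * q" "2 ^ Suc i = 4 * q" by auto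
    show "2 * (l + 1) \<le> 2 ^ i" "4 * (l + 1) \<le> 2 ^ Suc i" using l unfolding q by presburger+
  qed
  have pow: "(2 ^ Suc i + E (Suc i)) * f = 2 ^ i * f + 2 ^ i * f + E i * f + e (Suc i) * f"
    by (simp add: E_Suc algebra_simps)
  have lf: "(l + 2) * f \<le> 2 ^ i * f" if "1 \<le> i"
    using l1(1)[OF that] by (intro mult_le_mono1) simp
  define Jm where "Jm J' k = J'(?x := J' ?x - 2 * k, x i := J' (x i) + k)" for J' :: "'h \<Rightarrow> nat" and k
  have move: "solv D' J'" if "2 * k \<le> J' ?x" "solv D' (Jm J' k)" for D' J' k
    using that unfolding Jm_def by (rule solv_move[OF ax])
  show ?thesis
  proof (cases "f \<le> p (D ?x)")
    case True
    then obtain A where A: "p A + f = p (D ?x)" "\<And>J. solv (D(?x := A)) (J(?x := J ?x + 1)) \<Longrightarrow> solv D J"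
      using solv_collect_one[of D ?x, OF _ x_verts] by metis
    show ?thesis
    proof (rule A(2), cases "i = 0")
      case True
      then show "solv (D(?x := A)) (J(?x := J ?x + 1))"
        using J i l0 by (intro walk[of "Suc i"]) auto
    next
      case False
      have "tot i (D(?x := A)) = tot i D" "pz (D(?x := A)) (Suc i) = pz D (Suc i)"
        using i by (auto simp: tot_def pz_def x_eq_iff z_neq_x intro!: sum.cong)
      then have "tot (Suc i) (D(?x := A)) + f = tot (Suc i) D"
        using A(1) by (simp add: tot_Suc)
      then show "solv (D(?x := A)) (J(?x := J ?x + 1))"
        using False tot l1 J by (intro reserve_even[OF i IH, of "l + 1"]) (auto simp: algebra_simps)
    qed
  next
    case px: False
    show ?thesis
    proof (cases "Suc i \<in> S")
      case False
      then have tot': "2 ^ i * f + 2 ^ i * f + E i * f \<le> tot i D + p (D ?x) + 2 * (l * f) + f"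
        using tot pow by (simp add: tot_Suc pz_def e_def)
      show ?thesis
      proof (cases "i = 0")
        case True
        then show ?thesis using tot' px l0 by simp
      next
        case False
        then have i1: "1 \<le> i" by simp
        \<comment> \<open>The fewer than \<open>f\<close> pebbles over \<open>?x\<close> and one
          gathered pebble are given up; this is affordable as
          \<open>l + 2 \<le> 2 ^ i\<close>.\<close>
        have "(2 ^ i + E i) * f \<le> tot i D + l * f"
          using tot' px lf[OF i1] by (simp add: algebra_simps)
        then have "solv D (Jm J l)"
          using l1[OF i1] by (intro reserve_okD[OF IH[OF i1], of l]) (auto simp: Jm_def)
        then show ?thesis by (rule move[rotated]) (use J in simp)
      qed
    next
      case True
      then have az: "(?z, x i) \<in> parcs H" "(?z, ?x) \<in> parcs H" and neq: "?z \<noteq> x i" "?z \<noteq> ?x"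
        using arc_z[of i] i z_neq_x[of "Suc i"] by auto
      have tot': "2 ^ i * f + 2 ^ i * f + E i * f + f \<le> tot i D + p (D ?x) + p (D ?z) + 2 * (l * f) + f"
        using tot pow True by (simp add: tot_Suc pz_def e_def)
      obtain s where s: "p (D ?z) + r (D ?z) = 2 * s"
        using even_p_r by (blast elim: evenE)
      show ?thesis
      \<comment> \<open>The question is whether \<open>?z\<close> holds enough pairs to raise
        \<open>?x\<close> to \<open>f\<close> pebbles.\<close>
      proof (cases "p (D ?z) < r (D ?z) + 2 * (f - p (D ?x))")
        case True
        show ?thesis
        proof (cases "i = 0")
          case i0: True
          show ?thesis
          proof (rule solv_collect_move[OF az(2), of 1])
            \<comment> \<open>Few pairs among many pebbles means many odd vertices, which pushes
              \<open>p + r\<close> over \<open>?z\<close> above \<open>2 * f\<close>.\<close>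
            have "p (D ?x) + p (D ?z) \<ge> 2 * f" using tot' i0 l0 by simp
            then show "2 * 1 * f < p (D ?z) + r (D ?z) \<or> (1::nat) = 0"
              using True px by linarith
            show "solv (D(?z := 0)) (J(?x := J ?x + 1))"
              using J i i0 l0 by (intro walk[of "Suc i"]) auto
          qed
        next
          case False
          then have i1: "1 \<le> i" by simp
          from transfer_all[of _ _ D, OF az(1), of s] s obtain D1 where
            D1: "\<And>k. k \<noteq> ?z \<Longrightarrow> k \<noteq> x i \<Longrightarrow> D1 k = D k"
            "p (D (x i)) + p (D ?z) \<le> p (D1 (x i)) + s" "\<And>J. solv D1 J \<Longrightarrow> solv D J"
            by (metis order_refl)
          have "tot i D + p (D ?z) \<le> tot i D1 + s"
            using D1 i1 i \<open>Suc i \<in> S\<close> by (intro tot_change(1)) (auto simp: lev_def)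
          \<comment> \<open>Emptying \<open>?z\<close> and abandoning \<open>?x\<close> together
            cost less than \<open>2 * f\<close>.\<close>
          moreover have "s + p (D ?x) < 2 * f"
            using s True px r_le[of "D ?z"] by linarith
          ultimately have "(2 ^ i + E i) * f \<le> tot i D1 + l * f"
            using tot' lf[OF i1] by (simp add: algebra_simps)
          then have "solv D1 (Jm J l)"
            using l1[OF i1] by (intro reserve_okD[OF IH[OF i1], of l]) (auto simp: Jm_def)
          then have "solv D1 J" by (rule move[rotated]) (use J in simp)
          then show ?thesis by (rule D1(3))
        qed
      next
        case False
        \<comment> \<open>topping up \<open>?x\<close> to exactly \<open>f\<close> makes the number of gathered pebbles even\<close>
        define c where "c = f - p (D ?x)"
        have c: "p (D ?x) + c = f" using px by (simp add: c_def)
        have "2 * c + r (D ?z) \<le> p (D ?z)" using False by (simp add: c_def)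
        then obtain D1 where D1: "\<And>k. k \<noteq> ?z \<Longrightarrow> k \<noteq> ?x \<Longrightarrow> D1 k = D k"
          "p (D1 ?z) + 2 * c = p (D ?z)" "r (D1 ?z) = r (D ?z)" "p (D1 ?x) = p (D ?x) + c"
          "\<And>J. solv D1 J \<Longrightarrow> solv D J"
          using transfer[OF az(2), of c D] by metis
        have "f \<le> p (D1 ?x)" using D1(4) c by simp
        then obtain A where A: "\<And>J. solv (D1(?x := A)) (J(?x := J ?x + 1)) \<Longrightarrow> solv D1 J"
          using solv_collect_one[of D1 ?x, OF _ x_verts] by metis
        define D2 where "D2 = D1(?x := A)"
        define J2 where "J2 = J(?x := J ?x + 1)"
        have J2: "2 * (l + 1) \<le> J2 ?x" using J by (simp add: J2_def)
        have D2: "\<And>k. k \<noteq> ?z \<Longrightarrow> k \<noteq> ?x \<Longrightarrow> D2 k = D k" "D2 ?z = D1 ?z"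
          using D1(1) neq by (auto simp: D2_def)
        have "solv D2 J2"
        proof (cases "i = 0")
          case True
          then show ?thesis using J2 i l0 by (intro walk[of "Suc i"]) auto
        next
          case False
          then have i1: "1 \<le> i" by simp
          \<comment> \<open>The number of pebbles from \<open>?z\<close> that would complete the
            \<open>l + 1\<close> advanced ones to \<open>2 ^ i\<close>.\<close>
          define N :: nat where "N = 2 ^ i - (l + 1)"
          have N: "N + l + 1 = 2 ^ i" using l1[OF i1] by (simp add: N_def)
          have Nf: "N * f + l * f + f = 2 ^ i * f"
            unfolding N[symmetric] by (simp add: algebra_simps)
          have Jm: "l + 1 \<le> Jm J2 (l + 1) (x i)" by (simp add: Jm_def)
          have "solv D2 (Jm J2 (l + 1))"
          proof (cases "p (D2 ?z) + r (D2 ?z) \<le> 2 * (N * f)")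
            case True
            from transfer_all[of _ _ D2, OF az(1) True] obtain D3 where
              D3: "\<And>k. k \<noteq> ?z \<Longrightarrow> k \<noteq> x i \<Longrightarrow> D3 k = D2 k"
              "p (D2 (x i)) + p (D2 ?z) \<le> p (D3 (x i)) + N * f" "\<And>J. solv D3 J \<Longrightarrow> solv D2 J"
              by metis
            have "D2 (x i) = D (x i)" using D2(1) neq x_neq by metis
            then have "tot i D + p (D2 ?z) \<le> tot i D3 + N * f"
              using D3 D2(1) i1 i \<open>Suc i \<in> S\<close> by (intro tot_change(1)) (auto simp: lev_def)
            then have "(2 ^ i + E i) * f \<le> tot i D3 + (l + 1) * f"
              using tot' Nf D1(2) D2(2) c by (simp add: algebra_simps)
            then show ?thesis
              using l1[OF i1] Jm by (intro D3(3) reserve_okD[OF IH[OF i1], of "l + 1"]) auto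
          next
            case False
            show ?thesis
            proof (rule solv_collect_move[OF az(1), of N])
              show "solv (D2(?z := 0)) ((Jm J2 (l + 1))(x i := Jm J2 (l + 1) (x i) + N))"
                using i N Jm by (intro walk[of i]) auto
            qed (use False in simp)
          qed
          then show ?thesis by (rule move[rotated]) (rule J2)
        qed
        then show ?thesis
          unfolding D2_def J2_def using A D1(5) by blast
      qed
    qed
  qed
qed

lemma reserve: "1 \<le> i \<Longrightarrow> i \<le> m \<Longrightarrow> reserve_ok i"
proof (induction i)
  case (Suc i)
  then have IH: "1 \<le> i \<Longrightarrow> reserve_ok i" by simp
  show ?case
    unfolding reserve_ok_def
  proof (intro allI impI)
    fix D J and j :: nat
    assume *: "2 * j \<le> 2 ^ Suc i" "(2 ^ Suc i + E (Suc i)) * f \<le> tot (Suc i) D + j * f" "j \<le> J (x (Suc i))"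
    show "solv D J"
    proof (cases "even j")
      case True
      then obtain l where "j = 2 * l" by (elim evenE)
      then show ?thesis using * Suc.prems IH by (intro reserve_even[of i l]) auto
    next
      case False
      then obtain l where "j = 2 * l + 1" by (elim oddE)
      then show ?thesis using * Suc.prems IH by (intro reserve_odd[of i l]) auto
    qed
  qed
qed simp

end

section \<open>Two ladders with a common root\<close>

context ladder
begin

lemma tot_cong:
  assumes "\<And>k. k \<in> rungs i \<Longrightarrow> k \<noteq> root \<Longrightarrow> D' k = D k" "i \<le> m"
  shows "tot i D' = tot i D"
  unfolding tot_def
proof (rule sum.cong)
  fix k assume k: "k \<in> {1..i}"
  then have "x k \<noteq> root"
    using assms(2) x_eq_iff[of k 0] by (simp add: x_0[symmetric])
  then have "D' (x k) = D (x k)"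
    using k by (intro assms(1)) (auto simp: rungs_def)
  moreover have "z k \<noteq> root" if "k \<in> S"
    using z_neq_x[OF that, of 0] x_0 by simp
  then have "pz D' k = pz D k"
    using k by (auto simp: pz_def rungs_def assms(1))
  ultimately show "p (D' (x k)) + pz D' k = p (D (x k)) + pz D k"
    by simp
qed simp

lemma tot_top:
  assumes "1 \<le> m" "\<And>k. k \<in> rungs m \<Longrightarrow> k \<noteq> x m \<Longrightarrow> D' k = D k" "p (D' (x m)) = p (D (x m)) + c"
  shows "tot m D' = tot m D + c" "D' root = D root"
proof -
  obtain i where i: "m = Suc i" using assms(1) by (cases m) auto
  have "x k \<noteq> x m" if "k \<le> i" for k
    using x_eq_iff[of k m] i that by auto
  then have x: "D' (x k) = D (x k)" if "k \<le> i" for k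
    using that i by (intro assms(2)) (auto simp: rungs_def)
  then show "D' root = D root"
    using x_0 by auto
  have "pz D' k = pz D k" if "k \<le> m" for k
    using that z_neq_x[of k m] by (auto simp: pz_def rungs_def assms(2))
  then show "tot m D' = tot m D + c"
    unfolding i tot_def using x assms(3) by (simp add: i)
qed

lemma E_m: "E m = card S"
proof -
  have "E m = (\<Sum>k\<in>{1..m} \<inter> S. 1)"
    unfolding E_def e_def by (subst sum.inter_restrict) auto
  then show ?thesis
    using S by (simp add: Int_absorb1)
qed

lemma pebbles_rungs:
  "(\<Sum>h\<in>rungs m. p (D h)) \<le> p (D root) + tot m D"
proof -
  have fS: "finite S" using S finite_subset by blast
  have "(\<Sum>h\<in>rungs m. p (D h)) \<le> (\<Sum>h\<in>x ` {..m}. p (D h)) + (\<Sum>h\<in>z ` S. p (D h))"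
    unfolding rungs_def using S fS by (subst sum_Un_nat) (auto simp: Int_absorb1 subset_iff)
  also have "(\<Sum>h\<in>x ` {..m}. p (D h)) = (\<Sum>k\<le>m. p (D (x k)))"
    using inj_x by (simp add: sum.reindex)
  also have "\<dots> = p (D root) + (\<Sum>k=1..m. p (D (x k)))"
    by (simp add: atMost_atLeast0 sum.atLeast_Suc_atMost x_0)
  also have "(\<Sum>h\<in>z ` S. p (D h)) = (\<Sum>k\<in>{1..m} \<inter> S. p (D (z k)))"
    using inj_z S by (simp add: sum.reindex Int_absorb1)
  also have "\<dots> = (\<Sum>k=1..m. pz D k)"
    unfolding pz_def by (subst sum.inter_restrict) auto
  finally show ?thesis
    by (simp add: tot_def sum.distrib)
qed

end

locale double_ladder = pebbling_product H G f root t +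
  A: ladder H G f root t x z S m + B: ladder H G f root t y z' S m
  for H :: "'h pair_pre_digraph" and G :: "'a pair_pre_digraph" and f :: nat and root :: 'h and t :: 'a
    and x z y z' :: "nat \<Rightarrow> 'h" and S :: "nat set" and m :: nat +
  fixes w :: 'h
  assumes m: "1 \<le> m"
    and w_x: "(w, x m) \<in> parcs H" and w_y: "(w, y m) \<in> parcs H"
    and disjoint: "A.rungs m \<inter> B.rungs m \<subseteq> {root}"
    and w_notin: "w \<notin> A.rungs m" "w \<notin> B.rungs m"
    and cover: "pverts H \<subseteq> {w} \<union> A.rungs m \<union> B.rungs m"
begin

lemma solv_larger_side:
  assumes le: "B.tot m D \<le> A.tot m D"
    and total: "2 * ((2 ^ m + card S) * f) \<le> p (D root) + A.tot m D + B.tot m D + p (D w)"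
  shows "solv D J"
proof (rule ccontr)
  assume unsolv: "\<not> solv D J"
  define F where "F = (2 ^ m + card S) * f"
  have xm: "x m \<in> A.rungs m" "x m \<noteq> root"
    using m A.x_eq_iff[of m 0] A.x_0 by (auto simp: A.rungs_def)
  then have xm_B: "x m \<notin> B.rungs m" using disjoint by blast
  have cross: "A.tot m D' = A.tot m D + c \<and> D' root = D root \<and> B.tot m D' = B.tot m D"
    if "\<And>k. k \<noteq> w \<Longrightarrow> k \<noteq> x m \<Longrightarrow> D' k = D k" "p (D' (x m)) = p (D (x m)) + c" for D' c
  proof (intro conjI)
    show "A.tot m D' = A.tot m D + c" "D' root = D root"
      using A.tot_top[of D' D c] m that w_notin(1) by metis+
    show "B.tot m D' = B.tot m D"
      by (rule B.tot_cong[OF _ order_refl], metis that(1) w_notin(2) xm_B)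
  qed
  \<comment> \<open>\<open>c\<close> counts all pairs over \<open>w\<close>; as a first test they
    are all sent into the fuller ladder.\<close>
  define c where "c = (p (D w) - r (D w)) div 2"
  have c: "p (D w) = 2 * c + r (D w)"
    using even_p_r[of "D w"] r_le_p[of "D w"] by (auto simp: c_def)
  then obtain D1 where D1: "\<And>k. k \<noteq> w \<Longrightarrow> k \<noteq> x m \<Longrightarrow> D1 k = D k"
    "p (D1 (x m)) = p (D (x m)) + c" "\<And>J. solv D1 J \<Longrightarrow> solv D J"
    using transfer[OF w_x, of c D] by (metis order_refl)
  have cross1: "A.tot m D1 = A.tot m D + c" "D1 root = D root" "B.tot m D1 = B.tot m D"
    using cross[OF D1(1,2)] by blast+
  obtain D2 where D2: "\<And>k. k \<notin> A.rungs m \<Longrightarrow> D2 k = D1 k"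
    "p (D1 root) + A.tot m D1 + f \<le> p (D2 root) + F" "\<And>J. solv D2 J \<Longrightarrow> solv D1 J"
    using A.loss[of m D1] unsolv D1(3) unfolding F_def A.E_m by blast
  \<comment> \<open>Otherwise the first ladder alone would finish. The resulting bound
    \<open>small\<close> drives the second case below.\<close>
  have "\<not> f \<le> p (D2 root)"
    using unsolv D1(3) D2(3) solv_root_fibre by blast
  then have small: "p (D root) + A.tot m D + c < F"
    using D2(2) cross1 by simp
  show False
  proof (cases "p (D w) + r (D w) \<le> 2 * f")
    case True
    have "B.tot m D2 = B.tot m D"
      using B.tot_cong[of m D2 D1] D2(1) disjoint cross1 by auto
    moreover obtain D3 where
      D3: "p (D2 root) + B.tot m D2 + f \<le> p (D3 root) + F" "\<And>J. solv D3 J \<Longrightarrow> solv D2 J"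
      using B.loss[of m D2] unsolv D1(3) D2(3) unfolding F_def B.E_m by blast
    moreover have "p (D w) \<le> c + f"
      using True c by linarith
    ultimately have "f \<le> p (D3 root)"
      using total D2(2) unfolding F_def[symmetric] cross1 by linarith
    then show False
      using unsolv D1(3) D2(3) D3(2) solv_root_fibre by blast
  next
    case False
    have big: "f + 1 \<le> c + r (D w)"
      using False c by linarith
    \<comment> \<open>\<open>A.reserve\<close> does not count the pebbles over the root; this bounds
      them in terms of the other ladder.\<close>
    have gap: "p (D root) + A.tot m D + 2 \<le> B.tot m D + r (D w)"
      using small total c unfolding F_def[symmetric] by linarith
    \<comment> \<open>Transferring \<open>c'\<close> pairs leaves \<open>p + r = 2 * f + 2\<close>
      over \<open>w\<close>, the least even value for which two pebbles can still be gathered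
      there.\<close>
    define c' where "c' = c + r (D w) - (f + 1)"
    have c': "c' + f + 1 = c + r (D w)" using big by (simp add: c'_def)
    have "2 * c' + r (D w) \<le> p (D w)"
      using c c' r_le[of "D w"] by linarith
    then obtain D4 where D4: "\<And>k. k \<noteq> w \<Longrightarrow> k \<noteq> x m \<Longrightarrow> D4 k = D k"
      "p (D4 w) + 2 * c' = p (D w)" "r (D4 w) = r (D w)"
      "p (D4 (x m)) = p (D (x m)) + c'" "\<And>J. solv D4 J \<Longrightarrow> solv D J"
      using transfer[OF w_x, of c' D] by metis
    have cross4: "A.tot m D4 = A.tot m D + c'"
      using cross[OF D4(1,4)] by blast
    define D5 where "D5 = D4(w := 0)"
    have "A.tot m D5 = A.tot m D4"
      using w_notin by (intro A.tot_cong) (auto simp: D5_def)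
    \<comment> \<open>In \<open>total\<close>, \<open>gap\<close> eliminates the root and
      \<open>le\<close> replaces the other ladder by the fuller one.\<close>
    then have "F \<le> A.tot m D5 + 1 * f"
      using cross4 gap c c' total le unfolding F_def[symmetric] by linarith
    moreover have "2 * 1 \<le> (2::nat) ^ m"
      using m by (cases m) auto
    ultimately have "solv D5 (J(x m := J (x m) + 1))"
      using A.reserve[OF m] unfolding F_def A.E_m[symmetric]
      by (intro A.reserve_okD[of m 1]) auto
    moreover have "2 * 1 * f < p (D4 w) + r (D4 w)"
      using D4(2,3) c c' by linarith
    ultimately have "solv D4 J"
      using solv_collect_move[OF w_x, of 1 D4 J] unfolding D5_def by blast
    then show False
      using D4(5) unsolv by blast
  qed
qed

lemma swap: "double_ladder H G f root t y z' x z S m w"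
  by unfold_locales (use m w_x w_y disjoint w_notin cover in blast)+

lemma total_le: "(\<Sum>h\<in>pverts H. p (D h)) \<le> p (D root) + A.tot m D + B.tot m D + p (D w)"
proof -
  have fin: "finite (A.rungs m)" "finite (B.rungs m)"
    by (auto simp: A.rungs_def B.rungs_def)
  have root: "root \<in> A.rungs m" "root \<in> B.rungs m"
    unfolding A.x_0[symmetric] by (simp add: A.rungs_def)
      (unfold A.x_0 B.x_0[symmetric], simp add: B.rungs_def)
  have "(\<Sum>h\<in>pverts H. p (D h)) \<le> (\<Sum>h\<in>insert w (A.rungs m \<union> (B.rungs m - {root})). p (D h))"
    using fin cover root by (intro sum_mono2) auto
  also have "\<dots> = p (D w) + (\<Sum>h\<in>A.rungs m \<union> (B.rungs m - {root}). p (D h))"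
    using w_notin fin by (subst sum.insert) auto
  also have "\<dots> = p (D w) + ((\<Sum>h\<in>A.rungs m. p (D h)) + (\<Sum>h\<in>B.rungs m - {root}. p (D h)))"
    using fin disjoint by (subst sum.union_disjoint) auto
  finally show ?thesis
    using A.pebbles_rungs[of D] B.pebbles_rungs[of D] sum.remove[OF fin(2) root(2), of "\<lambda>h. p (D h)"]
    by linarith
qed

lemma solv_double_ladder:
  assumes "2 * ((2 ^ m + card S) * f) \<le> (\<Sum>h\<in>pverts H. p (D h))"
  shows "solv D J"
proof (cases "B.tot m D \<le> A.tot m D")
  case True
  then show ?thesis
    using assms total_le[of D] by (intro solv_larger_side) linarith+
next
  case False
  interpret swapped: double_ladder H G f root t y z' x z S m w
    by (rule swap)
  show ?thesis
    using False assms total_le[of D] by (intro swapped.solv_larger_side) linarith+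
qed

lemma can_pebble_double_ladder:
  assumes "2 * ((2 ^ m + card S) * f) \<le> pebbles HG D"
  shows "can_pebble HG D (root, t) 1"
proof -
  define D' where "D' h g = D (h, g)" for h g
  have "pebbles HG D = (\<Sum>h\<in>pverts H. p (D' h))"
    by (simp add: pebbles_def cartesian_product_def D'_def sum.cartesian_product)
  moreover have "config D' 0 = D"
    by (auto simp: config_def D'_def)
  ultimately show ?thesis
    using solv_double_ladder[of D' 0] assms by (simp add: solv_def)
qed

end

section \<open>Middle graphs of even cycles\<close>

lemma pebbling_product_pebbling_number:
  assumes "pair_graph H" "pair_graph G" "connected (with_proj G)" "odd_two_pebbling G"
    and "h \<in> pverts H" "t \<in> pverts G"
  shows "pebbling_product H G (pebbling_number G) h t"
proof -
  have fin: "finite (pverts G)" using pair_graphD(1)[OF assms(2)] .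
  obtain q where q: "pebbling_bound G q"
    using pebbling_bound_exists assms by blast
  then have bound: "pebbling_bound G (pebbling_number G)"
    unfolding pebbling_number_eq by (rule LeastI)
  show ?thesis
  proof (rule pebbling_product.intro)
    show "card (pverts G) \<le> pebbling_number G"
      using card_le_pebbling_number[OF fin q] assms(6) by blast
    show "can_pebble G A t 1" if "pebbling_number G \<le> pebbles G A" for A
      using pebbling_bound_ge[OF fin bound that assms(6)] .
    show "can_pebble G A t 2" if "2 * pebbling_number G < pebbles G A + card (odd_verts G A)" for A
      using assms(4,6) that by (auto simp: odd_two_pebbling_def)
  qed (use assms in simp_all)
qed

locale middle_even_cycle =
  fixes n :: nat
  assumes n: "2 \<le> n"
begin

abbreviation M where "M \<equiv> middle_graph (cycle_graph (2 * n))"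

text \<open>\<open>V i\<close> and \<open>U i\<close> are the vertices \<open>v\<^sub>i\<close> and \<open>u\<^sub>i\<close>, with integer indices read modulo \<open>2 * n\<close>.\<close>

definition res :: "int \<Rightarrow> nat" where "res i = nat (i mod (2 * int n))"
definition V :: "int \<Rightarrow> nat + nat set" where "V i = Inl (res i)"
definition U :: "int \<Rightarrow> nat + nat set" where "U i = Inr {res i, res (i + 1)}"

lemma res_less: "res i < 2 * n"
  using n by (auto simp: res_def nat_less_iff)

lemma res_Suc: "res (i + 1) = (res i + 1) mod (2 * n)"
proof -
  have "(i + 1) mod (2 * int n) = (i mod (2 * int n) + 1) mod (2 * int n)"
    by (simp add: mod_simps)
  also have "\<dots> = int ((res i + 1) mod (2 * n))"
    using n by (simp add: res_def of_nat_mod ac_simps)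
  finally show ?thesis by (simp add: res_def)
qed

lemma res_of_nat: "k < 2 * n \<Longrightarrow> res (int k) = k"
  by (simp add: res_def)

lemma res_eq_iff:
  assumes "i - j < 2 * int n" "j - i < 2 * int n"
  shows "res i = res j \<longleftrightarrow> i = j"
proof
  assume "res i = res j"
  then have "i mod (2 * int n) = j mod (2 * int n)"
    using n by (simp add: res_def nat_eq_iff2)
  then have "2 * int n dvd \<bar>i - j\<bar>"
    by (simp add: mod_eq_dvd_iff)
  then show "i = j"
    using assms zdvd_imp_le[of "2 * int n" "\<bar>i - j\<bar>"] by fastforce
qed simp

lemma periodic: "V (i + 2 * int n) = V i" "U (i + 2 * int n) = U i"
proof -
  have "res (i + d + 2 * int n) = res (i + d)" for d
    by (simp add: res_def)
  from this[of 0] this[of 1] show "V (i + 2 * int n) = V i" "U (i + 2 * int n) = U i"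
    by (simp_all add: V_def U_def ac_simps)
qed

lemma V_eq_iff: "i - j < 2 * int n \<Longrightarrow> j - i < 2 * int n \<Longrightarrow> V i = V j \<longleftrightarrow> i = j"
  by (simp add: V_def res_eq_iff)

lemma U_eq_iff:
  assumes "i - j < 2 * int n" "j - i < 2 * int n"
  shows "U i = U j \<longleftrightarrow> i = j"
proof
  assume "U i = U j"
  then consider "res i = res j" | "res i = res (j + 1)" "res (i + 1) = res j"
    by (auto simp: U_def doubleton_eq_iff)
  then show "i = j"
  proof cases
    case 1
    then show ?thesis using res_eq_iff[OF assms] by simp
  next
    case 2
    \<comment> \<open>Interchanged endpoints would make \<open>res i + 2\<close> congruent to
      \<open>res i\<close> modulo \<open>2 * n\<close>, impossible as
      \<open>2 * n \<ge> 4\<close>.\<close>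
    have "(res i + 2) mod (2 * n) = res (i + 1 + 1)"
      unfolding res_Suc by (simp add: mod_simps)
    also have "\<dots> = res i"
      unfolding res_Suc[of "i + 1"] 2(2) res_Suc[of j, symmetric] 2(1) ..
    finally show ?thesis
      using res_less[of i] n by (cases "res i + 2 < 2 * n") (auto simp: mod_if split: if_splits)
  qed
qed simp

lemma U_neq_V [simp]: "U i \<noteq> V j" "V j \<noteq> U i"
  by (auto simp: U_def V_def)

lemma uedge: "{res i, res (i + 1)} \<in> uedges (cycle_graph (2 * n))"
  using res_less[of i] by (auto simp: uedges_cycle_graph res_Suc)

lemma arcs_U:
  "(U i, V i) \<in> parcs M" "(U i, V (i + 1)) \<in> parcs M" "(V i, U i) \<in> parcs M" "(V (i + 1), U i) \<in> parcs M"
  "(U i, U (i + 1)) \<in> parcs M" "(U (i + 1), U i) \<in> parcs M"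
proof -
  have "U i \<noteq> U (i + 1)"
    using n by (subst U_eq_iff) auto
  then have "{res i, res (i + 1)} \<noteq> {res (i + 1), res (i + 1 + 1)}"
    by (simp add: U_def)
  then show "(U i, V i) \<in> parcs M" "(U i, V (i + 1)) \<in> parcs M" "(V i, U i) \<in> parcs M"
    "(V (i + 1), U i) \<in> parcs M" "(U i, U (i + 1)) \<in> parcs M" "(U (i + 1), U i) \<in> parcs M"
    using uedge[of i] uedge[of "i + 1"] unfolding middle_graph_def U_def V_def by auto
qed

lemma arcs_diff:
  "j = i \<or> j = i + 1 \<Longrightarrow> (U i, V j) \<in> parcs M" "j = i \<or> j = i + 1 \<Longrightarrow> (V j, U i) \<in> parcs M"
  "j = i + 1 \<or> i = j + 1 \<Longrightarrow> (U i, U j) \<in> parcs M"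
  using arcs_U by auto

lemma window:
  obtains k' where "a \<le> k'" "k' < a + 2 * int n" "V k = V k'" "U k = U k'"
proof -
  define k' where "k' = a + (k - a) mod (2 * int n)"
  have "(k' + d) mod (2 * int n) = (k + d) mod (2 * int n)" for d
  proof -
    have "(k' + d) mod (2 * int n) = ((a + d) + (k - a) mod (2 * int n)) mod (2 * int n)"
      by (simp add: k'_def algebra_simps)
    also have "\<dots> = ((a + d) + (k - a)) mod (2 * int n)"
      by (rule mod_add_right_eq)
    finally show ?thesis by (simp add: algebra_simps)
  qed
  from this[of 0] this[of 1] have "res k' = res k" "res (k' + 1) = res (k + 1)"
    by (simp_all add: res_def)
  moreover have "a \<le> k'" "k' < a + 2 * int n"
    using n by (auto simp: k'_def)
  ultimately show thesis
    using that[of k'] by (simp add: V_def U_def)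
qed

lemma pverts_cycle_graph: "pverts (cycle_graph k) = {..<k}"
  by (simp add: cycle_graph_def)

text \<open>The periods for the two kinds of vertices start independently, since the ladders around
  a root may cover them in different index ranges.\<close>

lemma vertex_cases:
  assumes "h \<in> pverts M"
  obtains (V) k where "a \<le> k" "k < a + 2 * int n" "h = V k" | (U) k where "b \<le> k" "k < b + 2 * int n" "h = U k"
proof -
  from assms consider k where "k < 2 * n" "h = Inl k" | k where "k < 2 * n" "h = Inr {k, (k + 1) mod (2 * n)}"
    by (auto simp: middle_graph_def uedges_cycle_graph pverts_cycle_graph)
  then show thesis
  proof cases
    case 1
    then have "h = V (int k)" by (simp add: V_def res_of_nat)
    then show thesis using window[of a "int k"] V by metis
  next
    case 2
    then have "h = U (int k)" by (simp add: U_def res_Suc res_of_nat)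
    then show thesis using window[of b "int k"] U by metis
  qed
qed

section \<open>Double ladders from the two kinds of roots\<close>

text \<open>Both paths follow the inserted vertices, with the original ones as extra vertices.
  \<open>S\<close> starts at 2 because the extra vertex of the first step would be the root
  itself.\<close>

lemma double_ladder_V:
  assumes "pebbling_product M G f (V c) t"
  shows "double_ladder M G f (V c) t
    (\<lambda>i. if i = 0 then V c else U (c + int i - 1)) (\<lambda>i. V (c + int i - 1))
    (\<lambda>i. if i = 0 then V c else U (c - int i)) (\<lambda>i. V (c - int i + 1)) {2..n} n (V (c + int n))"
    (is "double_ladder _ _ _ _ _ ?x ?z ?y ?z' ?S _ _")
proof -
  have A: "ladder M G f (V c) t ?x ?z ?S n"
    by (intro ladder.intro assms ladder_axioms.intro inj_onI)
      (auto simp: U_eq_iff V_eq_iff intro!: arcs_diff split: if_splits)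
  have B: "ladder M G f (V c) t ?y ?z' ?S n"
    by (intro ladder.intro assms ladder_axioms.intro inj_onI)
      (auto simp: U_eq_iff V_eq_iff intro!: arcs_diff split: if_splits)
  show ?thesis
  proof (intro double_ladder.intro assms A B double_ladder_axioms.intro)
    show "ladder.rungs ?x ?z ?S n \<inter> ladder.rungs ?y ?z' ?S n \<subseteq> {V c}"
      unfolding ladder.rungs_def[OF A] ladder.rungs_def[OF B]
      by (auto simp: U_eq_iff V_eq_iff split: if_splits)
    show "V (c + int n) \<notin> ladder.rungs ?x ?z ?S n" "V (c + int n) \<notin> ladder.rungs ?y ?z' ?S n"
      unfolding ladder.rungs_def[OF A] ladder.rungs_def[OF B]
      using n by (auto simp: U_eq_iff V_eq_iff split: if_splits)
    show "pverts M \<subseteq> {V (c + int n)} \<union> ladder.rungs ?x ?z ?S n \<union> ladder.rungs ?y ?z' ?S n"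
    proof
      fix h assume "h \<in> pverts M"
      then show "h \<in> {V (c + int n)} \<union> ladder.rungs ?x ?z ?S n \<union> ladder.rungs ?y ?z' ?S n"
      proof (cases rule: vertex_cases[where a = "c - int n + 1" and b = "c - int n"])
        case (V k)
        consider "k = c + int n" | "k = c" | "c < k" "k < c + int n" | "k < c" using V by linarith
        then show ?thesis
        proof cases
          case 2
          then have "h = ?x 0" "(0::nat) \<in> {..n}" using V by auto
          then show ?thesis unfolding ladder.rungs_def[OF A] by blast
        next
          case 3
          then have "h = ?z (nat (k - c + 1))" "nat (k - c + 1) \<in> {..n} \<inter> ?S" using V by auto
          then show ?thesis unfolding ladder.rungs_def[OF A] by blast
        next
          case 4
          then have "h = ?z' (nat (c - k + 1))" "nat (c - k + 1) \<in> {..n} \<inter> ?S" using V by auto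
          then show ?thesis unfolding ladder.rungs_def[OF B] by blast
        qed (use V in simp)
      next
        case (U k)
        show ?thesis
        proof (cases "c \<le> k")
          case True
          then have "h = ?x (nat (k - c + 1))" "nat (k - c + 1) \<in> {..n}" using U by auto
          then show ?thesis unfolding ladder.rungs_def[OF A] by blast
        next
          case False
          then have "h = ?y (nat (c - k))" "nat (c - k) \<in> {..n}" using U by auto
          then show ?thesis unfolding ladder.rungs_def[OF B] by blast
        qed
      qed
    qed
    \<comment> \<open>The second ladder runs through decreasing indices, so its far end meets the
      antipode only after adding the period.\<close>
    have "(V (c + int n), U (c - int n + 2 * int n)) \<in> parcs M"
      by (intro arcs_diff) simp
    then show "(V (c + int n), ?y n) \<in> parcs M"
      unfolding periodic using n by simp
    show "(V (c + int n), ?x n) \<in> parcs M" using n by (auto intro!: arcs_diff)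
  qed (use n in auto)
qed

text \<open>Both paths end in the two original neighbours of the antipode
  \<open>U (c + int n)\<close>. The last step thus has no extra vertex, and \<open>S\<close> again
  has \<open>n - 1\<close> elements.\<close>

lemma double_ladder_U:
  assumes "pebbling_product M G f (U c) t"
  shows "double_ladder M G f (U c) t
    (\<lambda>i. if i < n then U (c + int i) else V (c + int i)) (\<lambda>i. V (c + int i))
    (\<lambda>i. if i < n then U (c - int i) else V (c - int i + 1)) (\<lambda>i. V (c - int i + 1)) {1..<n} n (U (c + int n))"
    (is "double_ladder _ _ _ _ _ ?x ?z ?y ?z' ?S _ _")
proof -
  have A: "ladder M G f (U c) t ?x ?z ?S n"
    using n by (intro ladder.intro assms ladder_axioms.intro inj_onI)
      (auto simp: U_eq_iff V_eq_iff intro!: arcs_diff split: if_splits)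
  have B: "ladder M G f (U c) t ?y ?z' ?S n"
    using n by (intro ladder.intro assms ladder_axioms.intro inj_onI)
      (auto simp: U_eq_iff V_eq_iff intro!: arcs_diff split: if_splits)
  show ?thesis
  proof (intro double_ladder.intro assms A B double_ladder_axioms.intro)
    show "ladder.rungs ?x ?z ?S n \<inter> ladder.rungs ?y ?z' ?S n \<subseteq> {U c}"
      unfolding ladder.rungs_def[OF A] ladder.rungs_def[OF B]
      using n by (auto simp: U_eq_iff V_eq_iff split: if_splits)
    show "U (c + int n) \<notin> ladder.rungs ?x ?z ?S n" "U (c + int n) \<notin> ladder.rungs ?y ?z' ?S n"
      unfolding ladder.rungs_def[OF A] ladder.rungs_def[OF B]
      using n by (auto simp: U_eq_iff V_eq_iff split: if_splits)
    show "pverts M \<subseteq> {U (c + int n)} \<union> ladder.rungs ?x ?z ?S n \<union> ladder.rungs ?y ?z' ?S n"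
    proof
      fix h assume "h \<in> pverts M"
      then show "h \<in> {U (c + int n)} \<union> ladder.rungs ?x ?z ?S n \<union> ladder.rungs ?y ?z' ?S n"
      proof (cases rule: vertex_cases[where a = "c - int n + 1" and b = "c - int n + 1"])
        case (V k)
        consider "k = c + int n" | "k = c - int n + 1" | "c < k" "k < c + int n" | "c - int n + 1 < k" "k \<le> c"
          using V by linarith
        then show ?thesis
        proof cases
          case 1
          then have "h = ?x n" "n \<in> {..n}" using V by auto
          then show ?thesis unfolding ladder.rungs_def[OF A] by blast
        next
          case 2
          then have "h = ?y n" "n \<in> {..n}" using V by auto
          then show ?thesis unfolding ladder.rungs_def[OF B] by blast
        next
          case 3
          then have "h = ?z (nat (k - c))" "nat (k - c) \<in> {..n} \<inter> ?S" using V by auto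
          then show ?thesis unfolding ladder.rungs_def[OF A] by blast
        next
          case 4
          then have "h = ?z' (nat (c - k + 1))" "nat (c - k + 1) \<in> {..n} \<inter> ?S" using V by auto
          then show ?thesis unfolding ladder.rungs_def[OF B] by blast
        qed
      next
        case (U k)
        consider "k = c + int n" | "c \<le> k" "k < c + int n" | "k < c" using U by linarith
        then show ?thesis
        proof cases
          case 2
          then have "h = ?x (nat (k - c))" "nat (k - c) \<in> {..n}" using U by auto
          then show ?thesis unfolding ladder.rungs_def[OF A] by blast
        next
          case 3
          then have "h = ?y (nat (c - k))" "nat (c - k) \<in> {..n}" using U by auto
          then show ?thesis unfolding ladder.rungs_def[OF B] by blast
        qed (use U in simp)
      qed
    qed
    have "(U (c + int n), V (c - int n + 1 + 2 * int n)) \<in> parcs M"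
      by (intro arcs_diff) simp
    then show "(U (c + int n), ?y n) \<in> parcs M"
      unfolding periodic by simp
    show "(U (c + int n), ?x n) \<in> parcs M" by (auto intro!: arcs_diff)
  qed (use n in auto)
qed

lemma pebbling_bound_product:
  assumes "pair_graph G" "connected (with_proj G)" "odd_two_pebbling G"
  shows "pebbling_bound (cartesian_product M G) ((2 ^ (n + 1) + 2 * n - 2) * pebbling_number G)"
  unfolding pebbling_bound_def
proof (intro allI impI ballI)
  fix D v
  assume D: "pebbles (cartesian_product M G) D = (2 ^ (n + 1) + 2 * n - 2) * pebbling_number G"
    and v: "v \<in> pverts (cartesian_product M G)"
  obtain h t where v_eq: "v = (h, t)" and h: "h \<in> pverts M" and t: "t \<in> pverts G"
    using v by (auto simp: cartesian_product_def)
  have "2 ^ (n + 1) + 2 * n - 2 = 2 * (2 ^ n + (n - 1))"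
    using n by simp
  then have D': "2 * ((2 ^ n + (n - 1)) * pebbling_number G) \<le> pebbles (cartesian_product M G) D"
    using D by simp
  have "pair_graph M"
    using n by (intro pair_graph_middle_graph pair_graph_cycle_graph) simp
  then have base: "pebbling_product M G (pebbling_number G) h t"
    by (intro pebbling_product_pebbling_number assms h t)
  show "can_pebble (cartesian_product M G) D v 1"
    using h
  proof (cases rule: vertex_cases[where a = 0 and b = 0])
    case (V c)
    then show ?thesis
      using double_ladder.can_pebble_double_ladder[OF double_ladder_V[OF base[unfolded V(3)]], of D] D'
      unfolding v_eq V(3) by simp
  next
    case (U c)
    then show ?thesis
      using double_ladder.can_pebble_double_ladder[OF double_ladder_U[OF base[unfolded U(3)]], of D] D'
      unfolding v_eq U(3) by simp
  qed
qed

end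

section \<open>The pebbling number of the middle graph\<close>

text \<open>As the factor \<open>G\<close>, with pebbling number 1, it specialises the product bound
  to an upper bound for the middle graph itself.\<close>

definition one_vertex :: "unit pair_pre_digraph" where
  "one_vertex = \<lparr>pverts = {()}, parcs = {}\<rparr>"

lemma pair_graph_one_vertex: "pair_graph one_vertex"
  by (rule pair_graphI) (auto simp: one_vertex_def)

lemma connected_one_vertex: "connected (with_proj one_vertex)"
  by (auto simp: connected_def strongly_connected_def one_vertex_def reachable_def)

lemma pebbling_bound_one_vertex: "pebbling_bound one_vertex 1"
  by (auto simp: pebbling_bound_def can_pebble_def pebbles_def one_vertex_def)

lemma pebbling_number_one_vertex: "pebbling_number one_vertex = 1"
  using pebbling_number_le[OF pebbling_bound_one_vertex] card_le_pebbling_number[OF _ pebbling_bound_one_vertex]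
  by (auto simp: one_vertex_def)

lemma odd_two_pebbling_one_vertex: "odd_two_pebbling one_vertex"
  unfolding odd_two_pebbling_def pebbling_number_one_vertex
proof (intro allI impI ballI)
  fix D v assume "2 * 1 < pebbles one_vertex D + card (odd_verts one_vertex D)"
  moreover have "card (odd_verts one_vertex D) \<le> card {()}"
    by (intro card_mono) auto
  ultimately have "2 \<le> D v"
    by (simp add: pebbles_def one_vertex_def)
  then show "can_pebble one_vertex D v 2"
    by (auto simp: can_pebble_def)
qed

lemma pebbling_bound_times_one_vertex:
  assumes "pebbling_bound (cartesian_product K one_vertex) p"
  shows "pebbling_bound K p"
  unfolding pebbling_bound_def
proof (intro allI impI ballI)
  fix D v assume D: "pebbles K D = p" and v: "v \<in> pverts K"
  let ?K = "cartesian_product K one_vertex"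
  define lift where "lift E = (\<lambda>(h, u :: unit). E h)" for E :: "'a \<Rightarrow> nat"
  define proj where "proj E = (\<lambda>h. E (h, ()))" for E :: "'a \<times> unit \<Rightarrow> nat"
  have move: "pebbling_move K (proj E) (proj E')" if "pebbling_move ?K E E'" for E E'
    using that
  proof cases
    case (1 a b)
    then obtain h h' where hh': "a = (h, ())" "b = (h', ())" "(h, h') \<in> parcs K"
      by (auto simp: cartesian_product_def one_vertex_def)
    have "proj E' = (proj E)(h := proj E h - 2, h' := proj E h' + 1)"
      by (rule ext) (simp add: proj_def 1(1) hh')
    then show ?thesis
      using 1(3) hh' pebbling_move.intros[of h h' K "proj E"] by (simp add: proj_def)
  qed
  have "pebbles ?K (lift D) = p"
    using D by (simp add: pebbles_def cartesian_product_def one_vertex_def lift_def sum.cartesian_product[symmetric])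
  moreover have "(v, ()) \<in> pverts ?K"
    using v by (simp add: cartesian_product_def one_vertex_def)
  ultimately have "can_pebble ?K (lift D) (v, ()) 1"
    using assms by (auto simp: pebbling_bound_def)
  then obtain E where E: "(pebbling_move ?K)\<^sup>*\<^sup>* (lift D) E" "1 \<le> E (v, ())"
    by (auto simp: can_pebble_def)
  from E(1) have "(pebbling_move K)\<^sup>*\<^sup>* (proj (lift D)) (proj E)"
    by induction (auto intro: rtranclp.rtrancl_into_rtrancl move)
  moreover have "proj (lift D) = D" by (simp add: proj_def lift_def)
  ultimately show "can_pebble K D v 1"
    using E(2) by (auto simp: can_pebble_def proj_def)
qed

section \<open>The matching lower bound\<close>

context middle_even_cycle
begin

text \<open>The exponent is \<open>n\<close> minus the distance from \<open>v\<close> to 0 in the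
  cycle.\<close>

definition \<rho> :: "nat \<Rightarrow> nat" where "\<rho> v = 2 ^ (n - min v (2 * n - v))"

text \<open>The weight of a vertex at distance \<open>d\<close> from the vertex \<open>Inl 0\<close> is \<open>2 ^ (n + 1 - d)\<close>.\<close>

definition weight :: "nat + nat set \<Rightarrow> nat" where
  "weight h = (case h of Inl v \<Rightarrow> if v = 0 then 2 ^ (n + 1) else \<rho> v | Inr e \<Rightarrow> Max (\<rho> ` e))"

text \<open>The extremal distribution for the target \<open>Inl 0\<close>: the pile, at distance
  \<open>n + 1\<close>, stays one below the required \<open>2 ^ (n + 1)\<close>, and the single
  pebbles add \<open>2 * n - 2\<close>.\<close>

definition far_pile :: "nat + nat set \<Rightarrow> nat" where
  "far_pile h = (case h of Inl v \<Rightarrow> if v = 0 then 0 else if v = n then 2 ^ (n + 1) - 1 else 1 | Inr e \<Rightarrow> 0)"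

text \<open>The distance to 0 changes by at most one along an edge of the cycle.\<close>

lemma \<rho>_adjacent:
  assumes "e \<in> uedges (cycle_graph (2 * n))" "u \<in> e" "v \<in> e"
  shows "\<rho> u \<le> 2 * \<rho> v"
proof -
  obtain i where "i < 2 * n" "e = {i, (i + 1) mod (2 * n)}"
    using assms(1) by (auto simp: uedges_cycle_graph)
  then have "n - min u (2 * n - u) \<le> Suc (n - min v (2 * n - v))"
    using assms(2,3) n by (cases "i + 1 = 2 * n") auto
  then have "\<rho> u \<le> 2 ^ Suc (n - min v (2 * n - v))"
    unfolding \<rho>_def by (rule power_increasing) simp
  then show ?thesis by (simp add: \<rho>_def)
qed

lemma weight_Inr:
  assumes "e \<in> uedges (cycle_graph (2 * n))" "v \<in> e"
  shows "\<rho> v \<le> weight (Inr e)" "weight (Inr e) \<le> 2 * \<rho> v"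
proof -
  have "finite e" using assms(1) by (auto simp: uedges_cycle_graph)
  then show "\<rho> v \<le> weight (Inr e)" "weight (Inr e) \<le> 2 * \<rho> v"
    using assms \<rho>_adjacent[OF assms(1) _ assms(2)] by (auto simp: weight_def intro!: Max.boundedI)
qed

lemma weight_Inl: "\<rho> v \<le> weight (Inl v)" "weight (Inl v) \<le> 2 * \<rho> v" "v \<noteq> 0 \<Longrightarrow> weight (Inl v) = \<rho> v"
  by (auto simp: weight_def \<rho>_def)

lemma pair_graph_M: "pair_graph M"
  using n by (intro pair_graph_middle_graph pair_graph_cycle_graph) simp

lemma pebbling_bound_M: "pebbling_bound M (2 ^ (n + 1) + 2 * n - 2)"
  using pebbling_bound_times_one_vertex pebbling_bound_product[OF pair_graph_one_vertex
      connected_one_vertex odd_two_pebbling_one_vertex]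
  by (simp add: pebbling_number_one_vertex)

text \<open>Vertices in \<open>S\<close> have only inserted vertices as neighbours, which weigh at
  least as much. Single pebbles there count nothing, so the potential is that of the pile,
  \<open>2 ^ (n + 1) - 1\<close>, below the weight of the target.\<close>

lemma not_can_pebble_far_pile: "\<not> can_pebble M far_pile (Inl 0) 1"
proof (rule potential_bound[where w = weight and S = "{Inl v | v. v \<noteq> 0 \<and> v \<noteq> n}"])
  let ?S = "{Inl v | v. v \<noteq> 0 \<and> v \<noteq> n} :: (nat + nat set) set"
  show fin: "finite (pverts M)" using pair_graphD(1)[OF pair_graph_M] .
  show "x \<in> pverts M \<and> y \<in> pverts M \<and> x \<noteq> y" if "(x, y) \<in> parcs M" for x y
    using pair_graphD(2)[OF pair_graph_M that] by blast
  show "weight y \<le> 2 * weight x" if "(x, y) \<in> parcs M" for x y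
  proof -
    from that consider
        v e where "x = Inl v" "y = Inr e" "e \<in> uedges (cycle_graph (2 * n))" "v \<in> e"
      | v e where "x = Inr e" "y = Inl v" "e \<in> uedges (cycle_graph (2 * n))" "v \<in> e"
      | v e e' where "x = Inr e" "y = Inr e'" "e \<in> uedges (cycle_graph (2 * n))"
          "e' \<in> uedges (cycle_graph (2 * n))" "v \<in> e" "v \<in> e'"
      by (simp add: middle_graph_def disjoint_iff) blast
    then show ?thesis
    proof cases
      case 1
      then show ?thesis using weight_Inr[of e v] weight_Inl[of v] by simp
    next
      case 2
      then show ?thesis using weight_Inr[of e v] weight_Inl[of v] by simp
    next
      case 3
      then show ?thesis using weight_Inr[of e v] weight_Inr[of e' v] by simp
    qed
  qed
  show "x \<notin> ?S \<and> weight y \<le> weight x" if "(x, y) \<in> parcs M" "y \<in> ?S" for x y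
    using that weight_Inr(1) weight_Inl(3) by (auto simp: middle_graph_def)
  show "Inl 0 \<in> pverts M"
    using n by (simp add: middle_graph_def cycle_graph_def)
  show "Inl 0 \<notin> ?S" by simp
  let ?g = "\<lambda>x. weight x * (if x \<in> ?S then 2 * (far_pile x div 2) else far_pile x)"
  have "Inl n \<in> pverts M"
    using n by (simp add: middle_graph_def cycle_graph_def)
  then have "(\<Sum>x\<in>pverts M. ?g x) = ?g (Inl n) + (\<Sum>x\<in>pverts M - {Inl n}. ?g x)"
    using fin by (rule sum.remove[rotated])
  also have "(\<Sum>x\<in>pverts M - {Inl n}. ?g x) = 0"
    by (rule sum.neutral) (auto simp: far_pile_def split: sum.splits)
  also have "?g (Inl n) = 2 ^ (n + 1) - 1"
    using n by (simp add: far_pile_def weight_def \<rho>_def)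
  also have "\<dots> + 0 < weight (Inl 0)"
    by (simp add: weight_def)
  finally show "(\<Sum>x\<in>pverts M. ?g x) < weight (Inl 0)" .
qed

lemma pebbles_far_pile: "2 ^ (n + 1) + 2 * n - 3 \<le> pebbles M far_pile"
proof -
  have "(\<Sum>v<2 * n. far_pile (Inl v))
      = far_pile (Inl n) + (\<Sum>v\<in>{..<2 * n} - {n}. far_pile (Inl v))"
    using n by (intro sum.remove) auto
  also have "(\<Sum>v\<in>{..<2 * n} - {n}. far_pile (Inl v)) = (\<Sum>v\<in>{..<2 * n} - {n} - {0}. far_pile (Inl v))"
    using n by (subst sum.remove[of _ 0]) (auto simp: far_pile_def)
  also have "\<dots> = (\<Sum>v\<in>{..<2 * n} - {n} - {0}. 1)"
    by (rule sum.cong) (auto simp: far_pile_def)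
  also have "\<dots> = 2 * n - 2"
    using n by simp
  also have "far_pile (Inl n) = 2 ^ (n + 1) - 1"
    using n by (simp add: far_pile_def)
  finally have "(\<Sum>h\<in>Inl ` {..<2 * n}. far_pile h) = (2 ^ (n + 1) - 1) + (2 * n - 2)"
    by (simp add: sum.reindex)
  moreover have "(\<Sum>h\<in>Inl ` {..<2 * n}. far_pile h) \<le> pebbles M far_pile"
    unfolding pebbles_def using pair_graphD(1)[OF pair_graph_M]
    by (intro sum_mono2) (auto simp: middle_graph_def cycle_graph_def)
  ultimately show ?thesis
    using n by simp
qed

lemma pebbling_number_M: "pebbling_number M = 2 ^ (n + 1) + 2 * n - 2"
proof (rule antisym)
  show "pebbling_number M \<le> 2 ^ (n + 1) + 2 * n - 2"
    by (rule pebbling_number_le[OF pebbling_bound_M])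
  have "Inl 0 \<in> pverts M"
    using n by (simp add: middle_graph_def cycle_graph_def)
  then have "pebbles M far_pile < pebbling_number M"
    using pair_graphD(1)[OF pair_graph_M] pebbling_bound_M not_can_pebble_far_pile
    by (intro less_pebbling_number)
  then show "2 ^ (n + 1) + 2 * n - 2 \<le> pebbling_number M"
    using pebbles_far_pile by linarith
qed

end

theorem theorem3p8:
  fixes n :: nat and G :: "'a pair_pre_digraph"
  assumes "n \<ge> 2"
    and "pair_graph G"
    and "connected (with_proj G)"
    and "odd_two_pebbling G"
  shows "pebbling_number (cartesian_product (middle_graph (cycle_graph (2 * n))) G)
           \<le> pebbling_number (middle_graph (cycle_graph (2 * n))) * pebbling_number G
       \<and> pebbling_number (middle_graph (cycle_graph (2 * n))) * pebbling_number G
           = (2 ^ (n + 1) + 2 * n - 2) * pebbling_number G"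
proof -
  interpret middle_even_cycle n by unfold_locales fact
  show ?thesis
    using pebbling_number_le[OF pebbling_bound_product[OF assms(2-4)]] by (simp add: pebbling_number_M)
qed

end
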